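(* Let $d$ be the dimension, $m=d$, $\lambda>0$ with $\log d\lesssim \lambda\lesssim d$, and $w_\star,v\in\mathbb{S}^{d-1}$ with $v^\top w_\star=0$. Let $Q=I_d+\lambda vv^\top$, $P_\perp=I_d-w_\star w_\star^\top-vv^\top$, and $\mathcal L(W)=\mathbb{E}\big(y-\sum_{j=1}^m(w_j^\top x)^2\big)^2$ with $x\sim\mathcal N(0,Q)$, $y=(x^\top w_\star)^2+\nu$, $\nu\sim\mathcal N(0,\sigma^2)$ independent. Initialize $W_0=\theta U$ with $U^\top$ uniform on the Stiefel manifold (so $W_0W_0^\top=\theta^2I_d$), $\theta^2=\rho_0/d$, $\rho_0=1/\log d$, and run $W_{k+1}=W_k-\eta\,\mathrm{polar}(\nabla_W\mathcal L(W_k))$ with $\eta=\kappa/\sqrt{d+\lambda}$ for a sufficiently small absolute constant $\kappa>0$. Write $W_kW_k^\top=a_k w_\star w_\star^\top+b_k vv^\top+c_kP_\perp$, $T_1:=\inf\{k\ge0: b_{k+1}\le b_k\}$, and for a fixed sufficiently small constant $\delta>0$, $T_2:=\inf\{k\ge T_1: a_k\ge\delta\}$. Then for $d$ large enough: (i) $T_2=O(\eta^{-1})$; (ii) $a_k=(\sqrt{a_0}+k\eta)^2$ for all $T_1\le k\le T_2$, and $b_k=O((1+\lambda)^{-1})$, $c_k=O(d^{-1})$ for all $k\ge T_1$. Furthermore, for all $k\ge T_2$, $a_k=\Theta(1)$ and $\mathrm{Align}(k)=1-o(1)$.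
   Context: $\mathrm{polar}(A):=A(A^\top A)^{-1/2}$ (Moore–Penrose inverse square root). The alignment is $\mathrm{Align}(k)=\frac{\langle M_k,w_\star w_\star^\top\rangle_F}{\|M_k\|_F}=\frac{a_k}{\sqrt{a_k^2+b_k^2+(d-2)c_k^2}}$ with $M_k=W_kW_k^\top$. Asymptotic notation refers to $d\to\infty$. *)

theory Defs
  imports "HOL-Probability.Probability" "Jordan_Normal_Form.Matrix"
begin

definition outer :: "real Matrix.vec \<Rightarrow> real Matrix.vec \<Rightarrow> real mat" where
  "outer u w = mat (dim_vec u) (dim_vec w) (\<lambda>(i,j). u $ i * w $ j)"

definition unit_entry :: "nat \<Rightarrow> nat \<Rightarrow> nat \<Rightarrow> nat \<Rightarrow> real mat" where
  "unit_entry r c i j = mat r c (\<lambda>(a,b). if a = i \<and> b = j then 1 else 0)"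

definition frob_inner :: "real mat \<Rightarrow> real mat \<Rightarrow> real" where
  "frob_inner A B = (\<Sum>i<dim_row A. \<Sum>j<dim_col A. A $$ (i,j) * B $$ (i,j))"

definition frob_norm :: "real mat \<Rightarrow> real" where
  "frob_norm A = sqrt (frob_inner A A)"

definition diag_of :: "nat \<Rightarrow> (nat \<Rightarrow> real) \<Rightarrow> real mat" where
  "diag_of n \<mu> = mat n n (\<lambda>(i,j). if i = j then \<mu> i else 0)"

definition orth_mat :: "nat \<Rightarrow> real mat \<Rightarrow> bool" where
  "orth_mat n P \<longleftrightarrow> P \<in> carrier_mat n n \<and> P * transpose_mat P = 1\<^sub>m n"

definition pinv_sqrt :: "real mat \<Rightarrow> real mat" where
  "pinv_sqrt S = (SOME R. \<exists>P \<mu>. orth_mat (dim_row S) P \<and>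
       S = P * diag_of (dim_row S) \<mu> * transpose_mat P \<and>
       R = P * diag_of (dim_row S) (\<lambda>i. if \<mu> i > 0 then 1 / sqrt (\<mu> i) else 0) * transpose_mat P)"

definition polar :: "real mat \<Rightarrow> real mat" where
  "polar A = A * pinv_sqrt (transpose_mat A * A)"

definition std_gauss :: "nat \<Rightarrow> (nat \<Rightarrow> real) measure" where
  "std_gauss d = PiM {..<d} (\<lambda>_. std_normal_distribution)"

definition gauss_cov :: "nat \<Rightarrow> real mat \<Rightarrow> (nat \<Rightarrow> real) measure" where
  "gauss_cov d Q = (let A = (SOME A. A \<in> carrier_mat d d \<and> A * transpose_mat A = Q) in
     distr (std_gauss d) (PiM {..<d} (\<lambda>_. borel))
       (\<lambda>z. restrict (\<lambda>i. (A *\<^sub>v vec d z) $ i) {..<d}))"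

definition loss :: "nat \<Rightarrow> real mat \<Rightarrow> real Matrix.vec \<Rightarrow> real \<Rightarrow> real mat \<Rightarrow> real" where
  "loss d Q wstar \<sigma> W =
     (\<integral>xg. (let x = vec d (fst xg); y = (x \<bullet> wstar)\<^sup>2 + \<sigma> * snd xg in
              (y - (\<Sum>j<dim_col W. (col W j \<bullet> x)\<^sup>2))\<^sup>2)
       \<partial>(gauss_cov d Q \<Otimes>\<^sub>M std_normal_distribution))"

definition grad :: "(real mat \<Rightarrow> real) \<Rightarrow> real mat \<Rightarrow> real mat" where
  "grad L W = mat (dim_row W) (dim_col W)
     (\<lambda>(i,j). deriv (\<lambda>t. L (W + t \<cdot>\<^sub>m unit_entry (dim_row W) (dim_col W) i j)) 0)"

primrec pgd :: "(real mat \<Rightarrow> real) \<Rightarrow> real \<Rightarrow> real mat \<Rightarrow> nat \<Rightarrow> real mat" where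
  "pgd L \<eta> W0 0 = W0"
| "pgd L \<eta> W0 (Suc k) = pgd L \<eta> W0 k - \<eta> \<cdot>\<^sub>m polar (grad L (pgd L \<eta> W0 k))"

end

theory Submission
  imports Defs "Jordan_Normal_Form.Determinant" "HOL-Real_Asymp.Real_Asymp"
begin

text \<open>
  By Isserlis' formula the loss is \<open>\<sigma>\<^sup>2 + 2 tr(Q\<Delta>Q\<Delta>) + (tr(Q\<Delta>))\<^sup>2\<close> with \<open>\<Delta> = WW\<^sup>T - w\<^sub>\<star>w\<^sub>\<star>\<^sup>T\<close>,
  so its gradient is \<open>4 (2 Q\<Delta>Q + tr(Q\<Delta>) Q) W\<close>. Fix an orthonormal basis starting with \<open>w\<^sub>\<star>, v\<close>. If \<open>W = S U\<close>
  with \<open>S\<close> diagonal in this basis and \<open>U\<close> orthogonal, then the gradient has the same form, and the polar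
  factor replaces its eigenvalues by their signs. Hence every eigenvalue \<open>\<alpha>\<close> (along \<open>w\<^sub>\<star>\<close>), \<open>\<beta>\<close> (along \<open>v\<close>)
  and \<open>\<gamma>\<close> (on the rest) of \<open>S\<close> moves by \<open>\<eta>\<close> towards or away from zero, or rests.

  Whenever \<open>\<beta>\<close> grows, \<open>3 (1 + \<lambda>) \<beta>\<^sup>2 < 1\<close>, and whenever \<open>\<gamma>\<close> grows, \<open>(d - 2) \<gamma>\<^sup>2 < 1\<close>; as a single step is short,
  \<open>(1 + \<lambda>) \<beta>\<^sup>2 \<le> 1/2\<close> and \<open>(d - 2) \<gamma>\<^sup>2 \<le> 5/4\<close> at all times. Consequently \<open>3 (1 - \<alpha>\<^sup>2)\<close> exceeds
  \<open>(1 + \<lambda>) \<beta>\<^sup>2 + (d - 2) \<gamma>\<^sup>2\<close> as long as \<open>\<alpha>\<^sup>2 \<le> 1/4\<close>, so \<open>\<alpha>\<close> grows linearly up to that level, and it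
  stays bounded and bounded away from zero afterwards.
\<close>

unbundle no vec_syntax
no_notation inner (infix "\<bullet>" 70)

section \<open>The sign dynamics of the three eigenvalues\<close>

text \<open>A negative \<open>s\<close> pushes \<open>x\<close> away from zero by one step length.
  Otherwise the step is inward or zero; an inward step may cross zero, but then it ends within
  \<eta> of it, whence the maximum.\<close>

lemma abs_sgn_step:
  fixes x s \<eta> :: real
  assumes "\<eta> > 0"
  shows "s < 0 \<Longrightarrow> \<bar>x - \<eta> * (sgn s * sgn x)\<bar> \<le> \<bar>x\<bar> + \<eta>"
    and "s \<ge> 0 \<Longrightarrow> \<bar>x - \<eta> * (sgn s * sgn x)\<bar> \<le> max \<bar>x\<bar> \<eta>"
  using assms by (auto simp: sgn_real_def)

text \<open>Induction step of an a priori bound in the scale \<open>sqrt q * \<bar>x\<bar>\<close>: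
  growth is possible only below level \<open>r\<close>, and one step has scaled length at most
  \<kappa>, so \<open>r + \<kappa>\<close> is never passed. An inward step that crosses zero ends
  below \<kappa>, hence below that level too.\<close>

lemma scaled_sgn_step_bound:
  fixes x s \<eta> q \<kappa> r :: real
  assumes "\<eta> > 0" "q \<ge> 0" "\<eta> * sqrt q \<le> \<kappa>" "r \<ge> 0"
    and x: "q * x\<^sup>2 \<le> (r + \<kappa>)\<^sup>2" and s: "s < 0 \<Longrightarrow> q * x\<^sup>2 \<le> r\<^sup>2"
  shows "q * (x - \<eta> * (sgn s * sgn x))\<^sup>2 \<le> (r + \<kappa>)\<^sup>2"
proof -
  define y where "y = x - \<eta> * (sgn s * sgn x)"
  have k: "\<kappa> \<ge> 0" using assms(1-3) by (meson dual_order.trans less_imp_le mult_nonneg_nonneg real_sqrt_ge_zero)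
  have sq: "sqrt q * \<bar>z\<bar> \<le> t" if "q * z\<^sup>2 \<le> t\<^sup>2" "t \<ge> 0" for z t
    using real_sqrt_le_mono[OF that(1)] that(2) by (simp add: real_sqrt_mult)
  have "sqrt q * \<bar>y\<bar> \<le> r + \<kappa>"
  proof (cases "s < 0")
    case True
    have "sqrt q * \<bar>y\<bar> \<le> sqrt q * (\<bar>x\<bar> + \<eta>)"
      using abs_sgn_step(1)[OF assms(1) True, of x] assms(2) unfolding y_def
      by (intro mult_left_mono) auto
    also have "\<dots> = sqrt q * \<bar>x\<bar> + \<eta> * sqrt q" by (simp add: algebra_simps)
    also have "\<dots> \<le> r + \<kappa>" using sq[OF s[OF True] assms(4)] assms(3) by linarith
    finally show ?thesis .
  next
    case False
    have "sqrt q * \<bar>y\<bar> \<le> sqrt q * max \<bar>x\<bar> \<eta>"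
      using abs_sgn_step(2)[OF assms(1), of s x] False assms(2) unfolding y_def
      by (intro mult_left_mono) auto
    also have "\<dots> \<le> r + \<kappa>" 
      using sq[OF x] k assms(3,4) by (auto simp: max_def mult.commute)
    finally show ?thesis .
  qed
  hence "(sqrt q * \<bar>y\<bar>)\<^sup>2 \<le> (r + \<kappa>)\<^sup>2" by (intro power_mono) (use assms(2) in auto)
  thus ?thesis using assms(2) by (simp add: power_mult_distrib y_def)
qed

text \<open>The scalar recursions, detached from the matrices. Here \<open>n\<close> is the
  multiplicity d - 2 of the bulk eigenvalue \<gamma>, \<open>\<tau>\<close> is tr(Q \<Delta>), and
  the sign arguments are eigenvalues of the gradient without their positive factors.
  \<open>small_init\<close> says exactly that the bracket in \<open>beta_Suc\<close> is negative at
  time 0.\<close>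

locale sign_dynamics =
  fixes \<eta> lam n \<kappa> \<theta> :: real and \<alpha> \<beta> \<gamma> \<tau> :: "nat \<Rightarrow> real"
  assumes eta_pos: "\<eta> > 0" and theta_pos: "\<theta> > 0" and lam: "lam \<ge> 1" and n: "n \<ge> 0"
    and kappa: "\<kappa> \<le> 1/20" "\<eta> * sqrt (1 + lam) \<le> \<kappa>" "\<eta> * sqrt n \<le> \<kappa>"
    and init: "\<alpha> 0 = \<theta>" "\<beta> 0 = \<theta>" "\<gamma> 0 = \<theta>" and small_init: "(3 * (1 + lam) + n + 1) * \<theta>\<^sup>2 < 1"
    and tau: "\<And>k. \<tau> k = (\<alpha> k)\<^sup>2 - 1 + (1 + lam) * (\<beta> k)\<^sup>2 + n * (\<gamma> k)\<^sup>2"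
    and alpha_Suc: "\<And>k. \<alpha> (Suc k) = \<alpha> k - \<eta> * (sgn (2 * ((\<alpha> k)\<^sup>2 - 1) + \<tau> k) * sgn (\<alpha> k))"
    and beta_Suc: "\<And>k. \<beta> (Suc k) = \<beta> k - \<eta> * (sgn (2 * (1 + lam) * (\<beta> k)\<^sup>2 + \<tau> k) * sgn (\<beta> k))"
    and gamma_Suc: "\<And>k. \<gamma> (Suc k) = \<gamma> k - \<eta> * (sgn (2 * (\<gamma> k)\<^sup>2 + \<tau> k) * sgn (\<gamma> k))"
begin

lemma kappa_pos: "\<kappa> > 0"
  using kappa(2) eta_pos lam by (smt (verit) mult_pos_pos real_sqrt_gt_zero)

lemma eta_le: "\<eta> \<le> 1/20"
proof -
  have "\<eta> * 1 \<le> \<eta> * sqrt (1 + lam)" using eta_pos lam by (intro mult_left_mono) auto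
  thus ?thesis using kappa by linarith
qed

lemma beta_bound: "(1 + lam) * (\<beta> k)\<^sup>2 \<le> 1/2"
proof -
  \<comment> \<open>The level 3/5 is a rational number above 1/sqrt 3, the scaled value beyond which
    \<beta> cannot grow; with \<kappa> \<le> 1/20 the sum is at most 13/20, whose square is below
    1/2.\<close>
  have "(1 + lam) * (\<beta> k)\<^sup>2 \<le> (3/5 + \<kappa>)\<^sup>2"
  proof (induction k)
    case 0
    have "(1 + lam) * \<theta>\<^sup>2 \<le> 1/3" using small_init n by (simp add: algebra_simps) (smt (verit) mult_nonneg_nonneg zero_le_power2)
    also have "(1/3::real) \<le> (3/5)\<^sup>2" by (simp add: power2_eq_square)
    also have "\<dots> \<le> (3/5 + \<kappa>)\<^sup>2" using kappa_pos by (intro power_mono) auto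
    finally show ?case by (simp add: init)
  next
    case (Suc k)
    have "(1 + lam) * (\<beta> k)\<^sup>2 \<le> (3/5)\<^sup>2" if "2 * (1 + lam) * (\<beta> k)\<^sup>2 + \<tau> k < 0"
    proof -
      have "3 * ((1 + lam) * (\<beta> k)\<^sup>2) < 1" 
        using that n unfolding tau by (simp add: algebra_simps) (smt (verit) mult_nonneg_nonneg zero_le_power2)
      thus ?thesis by (simp add: power2_eq_square)
    qed
    thus ?case unfolding beta_Suc
      by (intro scaled_sgn_step_bound) (use Suc eta_pos lam kappa in auto)
  qed
  also have "\<dots> \<le> (13/20)\<^sup>2" using kappa kappa_pos by (intro power_mono) auto
  also have "\<dots> \<le> 1/2" by (simp add: power2_eq_square)
  finally show ?thesis .
qed

text \<open>Same scheme as for \<beta>, with level 1: when \<gamma> grows, the term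
  \<open>n * (\<gamma> k)\<^sup>2\<close> alone is below 1, and 5/4 exceeds the square of
  21/20.\<close>

lemma gamma_bound: "n * (\<gamma> k)\<^sup>2 \<le> 5/4"
proof -
  have "n * (\<gamma> k)\<^sup>2 \<le> (1 + \<kappa>)\<^sup>2"
  proof (induction k)
    case 0
    have "0 \<le> (3 * (1 + lam) + 1) * \<theta>\<^sup>2" using lam by simp
    hence "n * \<theta>\<^sup>2 \<le> 1\<^sup>2" using small_init by (simp add: algebra_simps)
    also have "\<dots> \<le> (1 + \<kappa>)\<^sup>2" using kappa_pos by (intro power_mono) auto
    finally show ?case by (simp add: init)
  next
    case (Suc k)
    have "n * (\<gamma> k)\<^sup>2 \<le> 1\<^sup>2" if "2 * (\<gamma> k)\<^sup>2 + \<tau> k < 0"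
    proof -
      have "0 \<le> (1 + lam) * (\<beta> k)\<^sup>2" using lam by simp
      thus ?thesis using that unfolding tau by (smt (verit) zero_le_power2 one_power2)
    qed
    thus ?case unfolding gamma_Suc
      by (intro scaled_sgn_step_bound) (use Suc eta_pos n kappa in auto)
  qed
  also have "\<dots> \<le> (21/20)\<^sup>2" using kappa kappa_pos by (intro power_mono) auto
  also have "\<dots> \<le> 5/4" by (simp add: power2_eq_square)
  finally show ?thesis .
qed

text \<open>The bracket in \<open>alpha_Suc\<close> is at most 3/4 - 3 + 1/2 + 5/4 = -1/2 by the two
  uniform bounds.\<close>

lemma alpha_grows:
  assumes "\<alpha> k > 0" "(\<alpha> k)\<^sup>2 \<le> 1/4"
  shows "\<alpha> (Suc k) = \<alpha> k + \<eta>"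
proof -
  have "2 * ((\<alpha> k)\<^sup>2 - 1) + \<tau> k < 0"
    using add_mono[OF mult_left_mono[OF assms(2), of 3] add_mono[OF beta_bound[of k] gamma_bound[of k]]]
    unfolding tau by simp
  thus ?thesis using assms(1) unfolding alpha_Suc by simp
qed

lemma beta_first_step: "\<beta> (Suc 0) = \<theta> + \<eta>"
proof -
  have "2 * (1 + lam) * (\<beta> 0)\<^sup>2 + \<tau> 0 < 0"
    using small_init unfolding tau init by (simp add: algebra_simps)
  thus ?thesis using theta_pos unfolding beta_Suc by (simp add: init)
qed

text \<open>As long as the square of \<beta> strictly increases, \<alpha> and \<beta> both grow by
  exactly \<eta> and remain equal, so the bound on \<beta> keeps \<alpha> in its growth
  regime.\<close>

lemma linear_phase:
  assumes "\<And>j. j < k \<Longrightarrow> \<not> (\<beta> (Suc j))\<^sup>2 \<le> (\<beta> j)\<^sup>2"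
  shows "\<beta> k = \<theta> + real k * \<eta>" "\<alpha> k = \<theta> + real k * \<eta>"
proof -
  have "\<beta> k = \<theta> + real k * \<eta> \<and> \<alpha> k = \<theta> + real k * \<eta>" using assms
  proof (induction k)
    case 0
    thus ?case by (simp add: init)
  next
    case (Suc k)
    hence IH: "\<beta> k = \<theta> + real k * \<eta>" "\<alpha> k = \<theta> + real k * \<eta>" by auto
    have pos: "\<beta> k > 0" using IH theta_pos eta_pos by (simp add: add_pos_nonneg)
    \<comment> \<open>Because \<open>lam \<ge> 1\<close>, the bound 1/2 of \<open>beta_bound\<close>
      becomes 1/4 for the common square.\<close>
    have "2 * (\<beta> k)\<^sup>2 \<le> (1 + lam) * (\<beta> k)\<^sup>2" using lam by (intro mult_right_mono) auto
    hence "(\<alpha> k)\<^sup>2 \<le> 1/4" using beta_bound[of k] IH by simp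
    hence \<alpha>: "\<alpha> (Suc k) = \<alpha> k + \<eta>" using pos IH by (intro alpha_grows) auto
    \<comment> \<open>At time 0, \<theta> may be smaller than \<eta>, and an inward step across zero
      could still increase the square, so the sign is computed directly. Later \<beta> is at least
      \<eta>, and then a strict increase rules out an inward step.\<close>
    have "\<beta> (Suc k) = \<beta> k + \<eta>"
    proof (cases "k = 0")
      case True
      thus ?thesis using beta_first_step by (simp add: init)
    next
      case False
      hence "1 * \<eta> \<le> real k * \<eta>" using eta_pos by (intro mult_right_mono) auto
      hence "\<eta> \<le> \<beta> k" using theta_pos IH by simp
      have "(\<beta> k)\<^sup>2 < (\<beta> (Suc k))\<^sup>2" using Suc.prems[of k] by simp
      hence lt: "\<beta> k < \<bar>\<beta> (Suc k)\<bar>" using pos by (metis abs_le_square_iff abs_of_pos not_le)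
      show ?thesis
      proof (cases "2 * (1 + lam) * (\<beta> k)\<^sup>2 + \<tau> k < 0")
        case True
        thus ?thesis using pos unfolding beta_Suc by simp
      next
        case False
        hence "\<bar>\<beta> (Suc k)\<bar> \<le> max \<bar>\<beta> k\<bar> \<eta>"
          unfolding beta_Suc by (intro abs_sgn_step(2)) (use eta_pos in auto)
        thus ?thesis using lt \<open>\<eta> \<le> \<beta> k\<close> pos by auto
      qed
    qed
    thus ?case using \<alpha> IH by (simp add: algebra_simps)
  qed
  thus "\<beta> k = \<theta> + real k * \<eta>" "\<alpha> k = \<theta> + real k * \<eta>" by auto
qed

lemma abs_beta_le: "\<bar>\<beta> k\<bar> \<le> 1/2"
proof -
  have "2 * (\<beta> k)\<^sup>2 \<le> (1 + lam) * (\<beta> k)\<^sup>2" using lam by (intro mult_right_mono) auto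
  hence "(\<beta> k)\<^sup>2 \<le> (1/2)\<^sup>2" using beta_bound[of k] by (simp add: power2_eq_square)
  thus ?thesis by (metis abs_le_square_iff abs_of_nonneg zero_le_divide_1_iff zero_le_numeral)
qed

text \<open>Otherwise the linear growth would go on for ever and carry \<beta> past its uniform
  bound 1/2.\<close>

lemma beta_stops: "\<exists>k. (\<beta> (Suc k))\<^sup>2 \<le> (\<beta> k)\<^sup>2"
proof (rule ccontr)
  assume "\<nexists>k. (\<beta> (Suc k))\<^sup>2 \<le> (\<beta> k)\<^sup>2"
  hence lin: "\<beta> k = \<theta> + real k * \<eta>" for k by (intro linear_phase) auto
  obtain k where "1/2 < real k * \<eta>" using reals_Archimedean3[OF eta_pos] by blast
  thus False using abs_beta_le[of k] lin[of k] theta_pos by simp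
qed

section \<open>Stopping times and the growth of the signal eigenvalue\<close>

text \<open>Squares are compared because b_k and a_k are the squares of \<beta> and \<alpha>. The
  minima are attained by \<open>beta_stops\<close> and, for \<delta> \<le> 1/4, by
  \<open>reaches_level\<close>.\<close>

definition T1 :: nat where "T1 = (LEAST k. (\<beta> (Suc k))\<^sup>2 \<le> (\<beta> k)\<^sup>2)"

definition T2 :: "real \<Rightarrow> nat" where "T2 \<delta> = (LEAST k. T1 \<le> k \<and> \<delta> \<le> (\<alpha> k)\<^sup>2)"

text \<open>The endpoint is included: the value at time k depends only on the steps j < k, all of
  which precede \<open>T1\<close>.\<close>

lemma before_T1: "k \<le> T1 \<Longrightarrow> \<beta> k = \<theta> + real k * \<eta>" "k \<le> T1 \<Longrightarrow> \<alpha> k = \<theta> + real k * \<eta>"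
  using linear_phase[of k] not_less_Least[of _ "\<lambda>k. (\<beta> (Suc k))\<^sup>2 \<le> (\<beta> k)\<^sup>2"]
  unfolding T1_def by (meson less_le_trans)+

text \<open>Up to \<open>T1\<close> the formula comes from \<open>before_T1\<close>; from then on
  \<delta> \<le> 1/4 keeps \<alpha> in the regime of \<open>alpha_grows\<close>. Only times j < k
  are constrained, so the formula still holds when the level is first reached.\<close>

lemma linear_growth:
  assumes "\<delta> \<le> 1/4" "\<And>j. T1 \<le> j \<Longrightarrow> j < k \<Longrightarrow> (\<alpha> j)\<^sup>2 < \<delta>"
  shows "\<alpha> k = \<theta> + real k * \<eta>"
  using assms(2)
proof (induction k)
  case (Suc k)
  show ?case
  proof (cases "Suc k \<le> T1")
    case False
    hence "(\<alpha> k)\<^sup>2 \<le> 1/4" using Suc.prems[of k] assms(1) by simp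
    moreover have IH: "\<alpha> k = \<theta> + real k * \<eta>" using Suc by auto
    moreover have "\<theta> + real k * \<eta> > 0" using theta_pos eta_pos by (simp add: add_pos_nonneg)
    ultimately show ?thesis using alpha_grows[of k] by (simp add: algebra_simps)
  qed (rule before_T1)
qed (simp add: init)

lemma reaches_level:
  assumes "\<delta> \<le> 1/4"
  shows "\<exists>k. T1 \<le> k \<and> \<delta> \<le> (\<alpha> k)\<^sup>2"
proof (rule ccontr)
  assume "\<nexists>k. T1 \<le> k \<and> \<delta> \<le> (\<alpha> k)\<^sup>2"
  hence *: "(\<alpha> k)\<^sup>2 < \<delta>" if "T1 \<le> k" for k using that by auto
  hence lin: "\<alpha> k = \<theta> + real k * \<eta>" for k by (intro linear_growth[OF assms]) auto
  obtain k where k: "1 < real k * \<eta>" using reals_Archimedean3[OF eta_pos] by blast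
  \<comment> \<open>The bound to be contradicted is available only from \<open>T1\<close> on, hence
    the maximum.\<close>
  have "1 < real (max k T1) * \<eta>" using k eta_pos by (smt (verit) max.cobounded1 mult_right_mono of_nat_mono)
  hence "1 < \<alpha> (max k T1)" using lin theta_pos by simp
  hence "1 < (\<alpha> (max k T1))\<^sup>2" by simp
  thus False using *[of "max k T1"] assms by simp
qed

lemma T2_props:
  assumes "\<delta> \<le> 1/4"
  shows "T1 \<le> T2 \<delta>" "\<delta> \<le> (\<alpha> (T2 \<delta>))\<^sup>2" "\<And>k. k \<le> T2 \<delta> \<Longrightarrow> \<alpha> k = \<theta> + real k * \<eta>"
proof -
  show "T1 \<le> T2 \<delta>" "\<delta> \<le> (\<alpha> (T2 \<delta>))\<^sup>2"
    using LeastI_ex[OF reaches_level[OF assms]] by (auto simp: T2_def)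
  show "\<alpha> k = \<theta> + real k * \<eta>" if "k \<le> T2 \<delta>" for k
  proof (rule linear_growth[OF assms])
    fix j assume "T1 \<le> j" "j < k"
    thus "(\<alpha> j)\<^sup>2 < \<delta>" using not_less_Least[of j "\<lambda>k. T1 \<le> k \<and> \<delta> \<le> (\<alpha> k)\<^sup>2"] that
      by (auto simp: T2_def)
  qed
qed

text \<open>At the time just before \<open>T2\<close>, \<alpha> is at most 1: either its square is
  below \<delta>, or that time precedes \<open>T1\<close> and the linear formula also gives \<beta>,
  which is at most 1/2. One more step costs at most \<eta>.\<close>

lemma T2_le:
  assumes "\<delta> \<le> 1/4"
  shows "real (T2 \<delta>) \<le> 2 / \<eta>"
proof (cases "T2 \<delta>")
  case 0
  thus ?thesis using eta_pos by simp
next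
  case (Suc k)
  have "\<theta> + real k * \<eta> \<le> 1"
  proof (cases "T1 \<le> k")
    case True
    have "(\<alpha> k)\<^sup>2 < \<delta>" using not_less_Least[of k "\<lambda>k. T1 \<le> k \<and> \<delta> \<le> (\<alpha> k)\<^sup>2"] True Suc
      by (auto simp: T2_def)
    hence "(\<theta> + real k * \<eta>)\<^sup>2 \<le> 1\<^sup>2" using T2_props(3)[OF assms, of k] Suc assms by simp
    thus ?thesis by (rule power2_le_imp_le) simp
  next
    case False
    thus ?thesis using before_T1(1)[of k] abs_beta_le[of k] abs_ge_self[of "\<beta> k"] by linarith
  qed
  hence "real (T2 \<delta>) * \<eta> \<le> 2" using Suc eta_le theta_pos by (simp add: algebra_simps)
  thus ?thesis using eta_pos by (simp add: field_simps)
qed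

text \<open>Below 1/2 the eigenvalue only grows, so it can decrease only from above 1/2, and one
  step then leaves it above 9/20. This may be less than \<open>sqrt \<delta>\<close>, which explains
  the factor 1/2 in the lower bound.\<close>

lemma alpha_after_T2:
  assumes "0 < \<delta>" "\<delta> \<le> 1/4" "T2 \<delta> \<le> k"
  shows "sqrt \<delta> / 2 \<le> \<alpha> k" "\<alpha> k \<le> 2"
proof -
  have s: "sqrt \<delta> \<le> 1/2" using real_sqrt_le_mono[OF assms(2)] by (simp add: real_sqrt_divide)
  have "sqrt \<delta> / 2 \<le> \<alpha> k" using assms(3)
  proof (induction k rule: nat_induct_at_least)
    case base
    have "0 \<le> \<alpha> (T2 \<delta>)" using T2_props(3)[OF assms(2), of "T2 \<delta>"] theta_pos eta_pos by simp
    hence "sqrt \<delta> \<le> \<alpha> (T2 \<delta>)" using real_le_lsqrt real_sqrt_le_mono[OF T2_props(2)[OF assms(2)]] by simp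
    thus ?case using assms(1) by (smt (verit) field_sum_of_halves real_sqrt_gt_zero)
  next
    case (Suc k)
    have pos: "\<alpha> k > 0" using Suc assms(1) by (smt (verit) half_gt_zero real_sqrt_gt_zero)
    show ?case
    proof (cases "\<alpha> k \<le> 1/2")
      case True
      hence "(\<alpha> k)\<^sup>2 \<le> (1/2)\<^sup>2" using pos by (intro power_mono) auto
      thus ?thesis using alpha_grows[OF pos] Suc eta_pos by (simp add: power2_eq_square)
    next
      case False
      have "\<alpha> k - \<eta> \<le> \<alpha> (Suc k)" using pos eta_pos unfolding alpha_Suc by (simp add: sgn_real_def)
      thus ?thesis using False s eta_le by linarith
    qed
  qed
  thus "sqrt \<delta> / 2 \<le> \<alpha> k" .
  \<comment> \<open>Valid at all times: a negative bracket forces the modulus below 1, and a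
    nonnegative one gives no growth apart from an overshoot of size at most \<eta>.\<close>
  have "\<bar>\<alpha> k\<bar> \<le> 2" for k
  proof (induction k)
    case 0
    have "1 * \<theta>\<^sup>2 \<le> (3 * (1 + lam) + n + 1) * \<theta>\<^sup>2" using lam n by (intro mult_right_mono) auto
    hence "\<theta>\<^sup>2 \<le> 1\<^sup>2" using small_init by simp
    hence "\<theta> \<le> 1" by (rule power2_le_imp_le) simp
    thus ?case using theta_pos by (simp add: init)
  next
    case (Suc k)
    show ?case
    proof (cases "2 * ((\<alpha> k)\<^sup>2 - 1) + \<tau> k < 0")
      case True
      have "0 \<le> (1 + lam) * (\<beta> k)\<^sup>2" "0 \<le> n * (\<gamma> k)\<^sup>2" using lam n by auto
      hence "(\<alpha> k)\<^sup>2 \<le> 1\<^sup>2" using True unfolding tau one_power2 by (smt (verit))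
      hence "\<bar>\<alpha> k\<bar> \<le> 1" by (simp add: abs_square_le_1)
      moreover have "\<bar>\<alpha> (Suc k)\<bar> \<le> \<bar>\<alpha> k\<bar> + \<eta>" unfolding alpha_Suc by (rule abs_sgn_step(1)[OF eta_pos True])
      ultimately show ?thesis using eta_le by linarith
    next
      case False
      hence "\<bar>\<alpha> (Suc k)\<bar> \<le> max \<bar>\<alpha> k\<bar> \<eta>"
        unfolding alpha_Suc by (intro abs_sgn_step(2)) (use eta_pos in auto)
      thus ?thesis using Suc eta_le by linarith
    qed
  qed
  thus "\<alpha> k \<le> 2" using abs_le_D1 by blast
qed

end

section \<open>Gaussian moments and the loss\<close>

lemma std_normal_moments:
  "(\<integral>x. x ^ 2 \<partial>std_normal_distribution) = (1::real)"
  "(\<integral>x. x ^ 4 \<partial>std_normal_distribution) = (3::real)"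
  "(\<integral>x. x ^ 1 \<partial>std_normal_distribution) = (0::real)"
  "(\<integral>x. x ^ 3 \<partial>std_normal_distribution) = (0::real)"
  "(\<integral>x. x ^ 0 \<partial>std_normal_distribution) = (1::real)"
  using std_normal_distribution_even_moments(1)[of 0] std_normal_distribution_even_moments(1)[of 1]
    std_normal_distribution_even_moments(1)[of 2]
    integral_std_normal_distribution_moment_odd[of 1] integral_std_normal_distribution_moment_odd[of 3]
  by (simp_all add: fact_numeral)

lemma prod_power_of_bool:
  fixes f :: "nat \<Rightarrow> real"
  assumes "i < d"
  shows "(\<Prod>n<d. f n ^ of_bool (n = i)) = f i"
proof -
  have "(\<Prod>n<d. f n ^ of_bool (n = i)) = (\<Prod>n<d. if n = i then f n else 1)"
    by (intro prod.cong) auto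
  thus ?thesis using assms by simp
qed

text \<open>Isserlis' formula for independent standard coordinates: grouping the factors by
  coordinate turns the expectation into a product of one-dimensional moments, and the coincidence
  patterns of the four indices are enumerated.\<close>

lemma std_gauss_moment4:
  assumes "i < d" "j < d" "k < d" "l < d"
  shows "has_bochner_integral (std_gauss d) (\<lambda>z. z i * z j * z k * z l)
    (of_bool (i = j) * of_bool (k = l) + of_bool (i = k) * of_bool (j = l) + of_bool (i = l) * of_bool (j = k))"
proof -
  interpret N: prob_space std_normal_distribution
    using real_dist_normal_dist by (simp add: real_distribution_def)
  interpret product_sigma_finite "\<lambda>_::nat. std_normal_distribution"
    by standard
  define m :: "nat \<Rightarrow> real" where "m = (\<lambda>e. \<integral>x. x ^ e \<partial>std_normal_distribution)"
  \<comment> \<open>\<open>c n\<close> counts the occurrences of n among the four indices.\<close>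
  define c :: "nat \<Rightarrow> nat" where "c = (\<lambda>n. of_bool (n = i) + of_bool (n = j) + of_bool (n = k) + of_bool (n = l))"
  have m: "m 0 = 1" "m (Suc 0) = 0" "m 2 = 1" "m 3 = 0" "m 4 = 3"
    "m (Suc (Suc 0)) = 1" "m (Suc (Suc (Suc 0))) = 0" "m (Suc (Suc (Suc (Suc 0)))) = 3"
    using std_normal_moments unfolding m_def by (simp_all add: numeral_eq_Suc)
  have z: "z i * z j * z k * z l = (\<Prod>n<d. z n ^ c n)" for z :: "nat \<Rightarrow> real"
    by (simp add: c_def power_add prod.distrib prod_power_of_bool assms)
  have "integrable (std_gauss d) (\<lambda>z. z i * z j * z k * z l)"
    unfolding z std_gauss_def
    by (intro product_integrable_prod) (auto intro: integrable_std_normal_distribution_moment)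
  moreover have "(\<integral>z. z i * z j * z k * z l \<partial>std_gauss d) = (\<Prod>n<d. m (c n))"
    unfolding z std_gauss_def m_def
    by (intro product_integral_prod) (auto intro: integrable_std_normal_distribution_moment)
  \<comment> \<open>A coordinate that does not occur contributes the moment of order 0, which is
    1.\<close>
  moreover have "(\<Prod>n<d. m (c n)) = (\<Prod>n\<in>{i,j,k,l}. m (c n))"
    using assms by (intro prod.mono_neutral_right) (auto simp: c_def m)
  moreover have "\<dots> = of_bool (i = j) * of_bool (k = l) + of_bool (i = k) * of_bool (j = l) + of_bool (i = l) * of_bool (j = k)"
    by (cases "i = j"; cases "i = k"; cases "i = l"; cases "j = k"; cases "j = l"; cases "k = l")
       (simp_all add: c_def m insert_commute)
  ultimately show ?thesis by (simp add: has_bochner_integral_iff)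
qed

lemma sum_product_sum:
  fixes f g :: "nat \<Rightarrow> nat \<Rightarrow> real"
  shows "(\<Sum>i<d. \<Sum>j<d. f i j) * (\<Sum>k<d. \<Sum>l<d. g k l) = (\<Sum>i<d. \<Sum>j<d. \<Sum>k<d. \<Sum>l<d. f i j * g k l)"
  unfolding sum_distrib_right unfolding sum_distrib_left ..

lemma sum_product4:
  fixes f g h r :: "nat \<Rightarrow> real"
  shows "(\<Sum>i<d. f i) * (\<Sum>i<d. g i) * (\<Sum>i<d. h i) * (\<Sum>i<d. r i) =
    (\<Sum>i<d. \<Sum>j<d. \<Sum>k<d. \<Sum>l<d. f i * g j * h k * r l)"
proof -
  have "(\<Sum>i<d. f i) * (\<Sum>i<d. g i) * ((\<Sum>i<d. h i) * (\<Sum>i<d. r i)) =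
    (\<Sum>i<d. \<Sum>j<d. \<Sum>k<d. \<Sum>l<d. f i * g j * (h k * r l))"
    unfolding sum_product[of f] sum_product[of h] sum_product_sum ..
  thus ?thesis by (simp add: mult.assoc)
qed

lemma sum_if_const: "(\<Sum>s\<in>A. if P then f s else 0) = (if P then \<Sum>s\<in>A. f s else (0::real))"
  by simp

text \<open>Each of the three pairings collapses two of the four sums. For rows of a factor
  \<open>A\<close>, the sums that remain are entries of \<open>A * transpose_mat A\<close>.\<close>

lemma sum4_delta:
  fixes f g h r :: "nat \<Rightarrow> real"
  shows "(\<Sum>p<d. \<Sum>q<d. \<Sum>s<d. \<Sum>t<d. f p * g q * h s * r t *
      (of_bool (p = q) * of_bool (s = t) + of_bool (p = s) * of_bool (q = t) + of_bool (p = t) * of_bool (q = s))) =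
    (\<Sum>p<d. f p * g p) * (\<Sum>p<d. h p * r p) + (\<Sum>p<d. f p * h p) * (\<Sum>p<d. g p * r p) +
    (\<Sum>p<d. f p * r p) * (\<Sum>p<d. g p * h p)"
proof -
  have "(\<Sum>p<d. \<Sum>q<d. \<Sum>s<d. \<Sum>t<d. f p * g q * h s * r t * (of_bool (p = q) * of_bool (s = t)))
     = (\<Sum>p<d. f p * g p) * (\<Sum>p<d. h p * r p)"
    by (simp add: of_bool_def if_distrib[of "\<lambda>x. _ * x"] sum.delta sum.delta' sum_if_const if_distrib[of "\<lambda>x. x * _"]
        sum_product mult.assoc cong: if_cong)
  moreover have "(\<Sum>p<d. \<Sum>q<d. \<Sum>s<d. \<Sum>t<d. f p * g q * h s * r t * (of_bool (p = s) * of_bool (q = t)))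
     = (\<Sum>p<d. f p * h p) * (\<Sum>p<d. g p * r p)"
    by (simp add: of_bool_def if_distrib[of "\<lambda>x. _ * x"] sum.delta sum.delta' sum_if_const if_distrib[of "\<lambda>x. x * _"]
        sum_product mult_ac cong: if_cong)
  moreover have "(\<Sum>p<d. \<Sum>q<d. \<Sum>s<d. \<Sum>t<d. f p * g q * h s * r t * (of_bool (p = t) * of_bool (q = s)))
     = (\<Sum>p<d. f p * r p) * (\<Sum>p<d. g p * h p)"
    by (simp add: of_bool_def if_distrib[of "\<lambda>x. _ * x"] sum.delta sum.delta' sum_if_const if_distrib[of "\<lambda>x. x * _"]
        sum_product mult_ac cong: if_cong)
  ultimately show ?thesis by (simp add: ring_distribs sum.distrib)
qed

lemma prob_space_std_gauss: "prob_space (std_gauss d)"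
  unfolding std_gauss_def using real_dist_normal_dist
  by (intro prob_space_PiM) (simp add: real_distribution_def)

text \<open>The factor of Q is an arbitrary choice; the moment computations use only that it is some
  square factor \<open>A\<close> with \<open>A * transpose_mat A = Q\<close>.\<close>

lemma gauss_cov_eq:
  assumes "\<exists>A. A \<in> carrier_mat d d \<and> A * transpose_mat A = Q"
  obtains A where "A \<in> carrier_mat d d" "A * transpose_mat A = Q"
    "gauss_cov d Q = distr (std_gauss d) (PiM {..<d} (\<lambda>_. borel))
       (\<lambda>z. \<lambda>i\<in>{..<d}. \<Sum>p<d. A $$ (i, p) * z p)"
proof -
  define A where "A = (SOME A. A \<in> carrier_mat d d \<and> A * transpose_mat A = Q)"
  have A: "A \<in> carrier_mat d d" "A * transpose_mat A = Q"
    using someI_ex[OF assms] unfolding A_def by auto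
  have "gauss_cov d Q = distr (std_gauss d) (PiM {..<d} (\<lambda>_. borel))
       (\<lambda>z. \<lambda>i\<in>{..<d}. (A *\<^sub>v vec d z) $ i)"
    unfolding gauss_cov_def A_def[symmetric] Let_def ..
  also have "(\<lambda>z. \<lambda>i\<in>{..<d}. (A *\<^sub>v vec d z) $ i) = (\<lambda>z. \<lambda>i\<in>{..<d}. \<Sum>p<d. A $$ (i, p) * z p)"
    using A(1) by (auto simp: fun_eq_iff restrict_def scalar_prod_def lessThan_atLeast0)
  finally show ?thesis using A that by blast
qed

lemma measurable_linear_std_gauss [measurable]:
  "(\<lambda>z. \<lambda>i\<in>{..<d}. \<Sum>p<d. A $$ (i, p) * z p) \<in> measurable (std_gauss d) (PiM {..<d} (\<lambda>_. borel :: real measure))"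
proof -
  have [measurable]: "(\<lambda>z. z p) \<in> borel_measurable (std_gauss d)" if "p < d" for p
    unfolding std_gauss_def using measurable_component_singleton[of p "{..<d}" "\<lambda>_. std_normal_distribution"] that by simp
  show ?thesis by (intro measurable_restrict) measurable
qed

lemma prob_space_gauss_cov:
  assumes "\<exists>A. A \<in> carrier_mat d d \<and> A * transpose_mat A = Q"
  shows "prob_space (gauss_cov d Q)" "sets (gauss_cov d Q) = sets (PiM {..<d} (\<lambda>_. borel))"
proof -
  obtain A where "A \<in> carrier_mat d d" "A * transpose_mat A = Q" and *: "gauss_cov d Q = distr (std_gauss d) (PiM {..<d} (\<lambda>_. borel))
       (\<lambda>z. \<lambda>i\<in>{..<d}. \<Sum>p<d. A $$ (i, p) * z p)" by (rule gauss_cov_eq[OF assms])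
  show "prob_space (gauss_cov d Q)" "sets (gauss_cov d Q) = sets (PiM {..<d} (\<lambda>_. borel))"
    unfolding * by (auto intro!: prob_space.prob_space_distr prob_space_std_gauss measurable_linear_std_gauss)
qed

text \<open>Isserlis' formula for covariance Q, by expanding x = A z and contracting the standard
  moments.\<close>

lemma gauss_cov_moment4:
  assumes "\<exists>A. A \<in> carrier_mat d d \<and> A * transpose_mat A = Q"
    and "i < d" "j < d" "k < d" "l < d"
  shows "has_bochner_integral (gauss_cov d Q) (\<lambda>x. x i * x j * x k * x l)
    (Q $$ (i,j) * Q $$ (k,l) + Q $$ (i,k) * Q $$ (j,l) + Q $$ (i,l) * Q $$ (j,k))"
proof -
  obtain A where A: "A \<in> carrier_mat d d" "A * transpose_mat A = Q" and
    *: "gauss_cov d Q = distr (std_gauss d) (PiM {..<d} (\<lambda>_. borel))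
       (\<lambda>z. \<lambda>i\<in>{..<d}. \<Sum>p<d. A $$ (i, p) * z p)" by (rule gauss_cov_eq[OF assms(1)])
  have Q: "Q $$ (i,j) = (\<Sum>p<d. A $$ (i,p) * A $$ (j,p))" if "i < d" "j < d" for i j
    using A that by (auto simp: scalar_prod_def lessThan_atLeast0)
  have "has_bochner_integral (std_gauss d)
     (\<lambda>z. \<Sum>p<d. \<Sum>q<d. \<Sum>s<d. \<Sum>t<d. A $$ (i,p) * A $$ (j,q) * A $$ (k,s) * A $$ (l,t) * (z p * z q * z s * z t))
     (\<Sum>p<d. \<Sum>q<d. \<Sum>s<d. \<Sum>t<d. A $$ (i,p) * A $$ (j,q) * A $$ (k,s) * A $$ (l,t) *
      (of_bool (p = q) * of_bool (s = t) + of_bool (p = s) * of_bool (q = t) + of_bool (p = t) * of_bool (q = s)))"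
    by (intro has_bochner_integral_sum has_bochner_integral_mult_right std_gauss_moment4) auto
  also have "(\<lambda>z. \<Sum>p<d. \<Sum>q<d. \<Sum>s<d. \<Sum>t<d. A $$ (i,p) * A $$ (j,q) * A $$ (k,s) * A $$ (l,t) * (z p * z q * z s * z t))
    = (\<lambda>z. (\<Sum>p<d. A $$ (i,p) * z p) * (\<Sum>p<d. A $$ (j,p) * z p) * (\<Sum>p<d. A $$ (k,p) * z p) * (\<Sum>p<d. A $$ (l,p) * z p))"
    unfolding sum_product4 by (simp add: mult_ac)
  finally show ?thesis
    unfolding * sum4_delta Q[OF assms(2,3)] Q[OF assms(4,5)] Q[OF assms(2,4)] Q[OF assms(3,5)] Q[OF assms(2,5)] Q[OF assms(3,4)]
    by (intro has_bochner_integral_distr measurable_linear_std_gauss) (use assms in auto)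
qed

section \<open>The population loss in closed form\<close>

text \<open>Independence of input and noise is expressed by the product measure, so expectations of
  products factor by Fubini.\<close>

lemma has_bochner_integral_pair_mult:
  fixes f :: "'a \<Rightarrow> real" and g :: "'b \<Rightarrow> real"
  assumes "prob_space M" "prob_space N" and f: "has_bochner_integral M f a" and g: "has_bochner_integral N g b"
  shows "has_bochner_integral (M \<Otimes>\<^sub>M N) (\<lambda>x. f (fst x) * g (snd x)) (a * b)"
proof -
  interpret M: prob_space M by fact
  interpret N: prob_space N by fact
  interpret pair_sigma_finite M N ..
  have fi: "integrable M f" "integral\<^sup>L M f = a" and gi: "integrable N g" "integral\<^sup>L N g = b"
    using f g by (auto simp: has_bochner_integral_iff)
  note [measurable] = borel_measurable_integrable[OF fi(1)] borel_measurable_integrable[OF gi(1)]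
  have int: "integrable (M \<Otimes>\<^sub>M N) (\<lambda>x. f (fst x) * g (snd x))"
  proof (rule Fubini_integrable)
    have "integrable M (\<lambda>x. \<bar>f x\<bar> * (\<integral>y. \<bar>g y\<bar> \<partial>N))" using fi by auto
    thus "integrable M (\<lambda>x. \<integral>y. norm (f (fst (x, y)) * g (snd (x, y))) \<partial>N)"
      using gi by (simp add: abs_mult)
    show "AE x in M. integrable N (\<lambda>y. f (fst (x, y)) * g (snd (x, y)))" using gi by auto
  qed measurable
  have "(\<integral>x. f (fst x) * g (snd x) \<partial>(M \<Otimes>\<^sub>M N)) = (\<integral>x. \<integral>y. f x * g y \<partial>N \<partial>M)"
    using integral_fst'[OF int] by simp
  also have "\<dots> = a * b" using fi gi by simp
  finally show ?thesis using int by (simp add: has_bochner_integral_iff)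
qed

lemma sum_mult_squared:
  fixes f g :: "nat \<Rightarrow> real"
  shows "(\<Sum>i<d. f i * g i)\<^sup>2 = (\<Sum>i<d. \<Sum>j<d. f i * f j * (g i * g j))"
  unfolding power2_eq_square sum_product by (simp add: mult_ac)

lemma quadratic_form_entries:
  fixes x :: "nat \<Rightarrow> real"
  assumes "dim_vec w = d" "W \<in> carrier_mat d m"
  shows "(vec d x \<bullet> w)\<^sup>2 - (\<Sum>j<m. (col W j \<bullet> vec d x)\<^sup>2) =
    (\<Sum>i<d. \<Sum>j<d. (w $ i * w $ j - (\<Sum>q<m. W $$ (i,q) * W $$ (j,q))) * (x i * x j))"
proof -
  have 1: "(vec d x \<bullet> w)\<^sup>2 = (\<Sum>i<d. \<Sum>j<d. w $ i * w $ j * (x i * x j))"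
  proof -
    have "vec d x \<bullet> w = (\<Sum>i<d. w $ i * x i)"
      unfolding scalar_prod_def lessThan_atLeast0 using assms(1) by (intro sum.cong) auto
    thus ?thesis by (simp only: sum_mult_squared)
  qed
  have "(col W q \<bullet> vec d x)\<^sup>2 = (\<Sum>i<d. \<Sum>j<d. W $$ (i,q) * W $$ (j,q) * (x i * x j))" if "q < m" for q
  proof -
    have "col W q \<bullet> vec d x = (\<Sum>i<d. W $$ (i,q) * x i)"
      using assms that by (simp add: scalar_prod_def lessThan_atLeast0)
    thus ?thesis by (simp only: sum_mult_squared)
  qed
  hence "(\<Sum>q<m. (col W q \<bullet> vec d x)\<^sup>2) = (\<Sum>q<m. \<Sum>i<d. \<Sum>j<d. W $$ (i,q) * W $$ (j,q) * (x i * x j))"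
    by simp
  also have "\<dots> = (\<Sum>i<d. \<Sum>q<m. \<Sum>j<d. W $$ (i,q) * W $$ (j,q) * (x i * x j))" by (rule sum.swap)
  also have "\<dots> = (\<Sum>i<d. \<Sum>j<d. \<Sum>q<m. W $$ (i,q) * W $$ (j,q) * (x i * x j))"
    by (intro sum.cong refl sum.swap)
  finally show ?thesis unfolding 1 by (simp add: algebra_simps sum_subtractf sum_distrib_left sum_distrib_right)
qed

text \<open>The residual is a quadratic form in x, with matrix \<open>N\<close> equal to minus
  \<Delta>, plus \<sigma> times the noise. In its square the cross term has mean zero, the noise
  contributes its variance, and the fourth moments of x give the rest.\<close>

lemma loss_closed_form:
  assumes Q: "\<exists>A. A \<in> carrier_mat d d \<and> A * transpose_mat A = Q"
    and w: "dim_vec w = d" and W: "W \<in> carrier_mat d m"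
  defines "N \<equiv> \<lambda>i j. w $ i * w $ j - (\<Sum>q<m. W $$ (i,q) * W $$ (j,q))"
  shows "loss d Q w \<sigma> W = \<sigma>\<^sup>2 + (\<Sum>i<d. \<Sum>j<d. \<Sum>k<d. \<Sum>l<d. N i j * N k l *
     (Q $$ (i,j) * Q $$ (k,l) + Q $$ (i,k) * Q $$ (j,l) + Q $$ (i,l) * Q $$ (j,k)))"
proof -
  define q where "q = (\<lambda>x::nat \<Rightarrow> real. \<Sum>i<d. \<Sum>j<d. N i j * (x i * x j))"
  interpret P: prob_space "gauss_cov d Q" by (rule prob_space_gauss_cov[OF Q])
  interpret G: prob_space std_normal_distribution
    using real_dist_normal_dist by (simp add: real_distribution_def)
  note [measurable_cong] = prob_space_gauss_cov(2)[OF Q]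
  have [measurable]: "q \<in> borel_measurable (gauss_cov d Q)" unfolding q_def by measurable
  define I where "I = (\<Sum>i<d. \<Sum>j<d. \<Sum>k<d. \<Sum>l<d. N i j * N k l *
     (Q $$ (i,j) * Q $$ (k,l) + Q $$ (i,k) * Q $$ (j,l) + Q $$ (i,l) * Q $$ (j,k)))"
  have "has_bochner_integral (gauss_cov d Q)
     (\<lambda>x. \<Sum>i<d. \<Sum>j<d. \<Sum>k<d. \<Sum>l<d. N i j * N k l * (x i * x j * x k * x l)) I"
    unfolding I_def
    by (intro has_bochner_integral_sum has_bochner_integral_mult_right gauss_cov_moment4[OF Q]) auto
  also have "(\<lambda>x. \<Sum>i<d. \<Sum>j<d. \<Sum>k<d. \<Sum>l<d. N i j * N k l * (x i * x j * x k * x l)) = (\<lambda>x. (q x)\<^sup>2)"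
    unfolding q_def power2_eq_square sum_product_sum by (simp add: mult_ac)
  finally have q2: "has_bochner_integral (gauss_cov d Q) (\<lambda>x. (q x)\<^sup>2) I" .
  \<comment> \<open>Only integrability matters here: the mean of \<open>q\<close> is later
    multiplied by the zero mean of the noise.\<close>
  hence q1: "has_bochner_integral (gauss_cov d Q) q (integral\<^sup>L (gauss_cov d Q) q)"
    using P.square_integrable_imp_integrable[of q] by (simp add: has_bochner_integral_iff)
  have one: "has_bochner_integral (gauss_cov d Q) (\<lambda>_. 1) (1::real)" "has_bochner_integral std_normal_distribution (\<lambda>_. 1) (1::real)"
    using P.prob_space G.prob_space by (auto simp: has_bochner_integral_iff)
  have g1: "has_bochner_integral std_normal_distribution (\<lambda>x. x) (0::real)"
    and g2: "has_bochner_integral std_normal_distribution (\<lambda>x. x\<^sup>2) (1::real)"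
    using std_normal_moments integrable_std_normal_distribution_moment[of 1] integrable_std_normal_distribution_moment[of 2]
    by (auto simp: has_bochner_integral_iff)
  note pm = has_bochner_integral_pair_mult[OF P.prob_space_axioms G.prob_space_axioms]
  have "has_bochner_integral (gauss_cov d Q \<Otimes>\<^sub>M std_normal_distribution)
    (\<lambda>x. (q (fst x))\<^sup>2 * 1 + 2 * \<sigma> * (q (fst x) * snd x) + \<sigma>\<^sup>2 * (1 * (snd x)\<^sup>2))
    (I * 1 + 2 * \<sigma> * (integral\<^sup>L (gauss_cov d Q) q * 0) + \<sigma>\<^sup>2 * (1 * 1))"
    by (intro has_bochner_integral_add has_bochner_integral_mult_right pm[OF q2 one(2)] pm[OF q1 g1] pm[OF one(1) g2])
  also have "(\<lambda>x. (q (fst x))\<^sup>2 * 1 + 2 * \<sigma> * (q (fst x) * snd x) + \<sigma>\<^sup>2 * (1 * (snd x)\<^sup>2)) =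
    (\<lambda>xg. (q (fst xg) + \<sigma> * snd xg)\<^sup>2)"
    by (auto simp: fun_eq_iff power2_eq_square algebra_simps)
  also have "\<dots> = (\<lambda>xg. let x = vec d (fst xg); y = (x \<bullet> w)\<^sup>2 + \<sigma> * snd xg in
              (y - (\<Sum>j<dim_col W. (col W j \<bullet> x)\<^sup>2))\<^sup>2)"
  proof
    fix xg :: "(nat \<Rightarrow> real) \<times> real"
    have "q (fst xg) + \<sigma> * snd xg = (vec d (fst xg) \<bullet> w)\<^sup>2 + \<sigma> * snd xg - (\<Sum>j<dim_col W. (col W j \<bullet> vec d (fst xg))\<^sup>2)"
      using quadratic_form_entries[OF w W, of "fst xg"] W by (simp add: q_def N_def)
    thus "(q (fst xg) + \<sigma> * snd xg)\<^sup>2 = (let x = vec d (fst xg); y = (x \<bullet> w)\<^sup>2 + \<sigma> * snd xg in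
              (y - (\<Sum>j<dim_col W. (col W j \<bullet> x)\<^sup>2))\<^sup>2)" by (simp only: Let_def)
  qed
  finally show ?thesis unfolding loss_def I_def[symmetric] by (simp add: has_bochner_integral_iff)
qed

section \<open>Spectral calculus and the polar factor\<close>

lemma mult_mat_entry:
  assumes "A \<in> carrier_mat n k" "B \<in> carrier_mat k m" "i < n" "j < m"
  shows "(A * B) $$ (i,j) = (\<Sum>l<k. A $$ (i,l) * B $$ (l,j))"
  using assms by (simp add: scalar_prod_def lessThan_atLeast0)

lemma mult_carrier_square [simp]:
  "A \<in> carrier_mat n n \<Longrightarrow> B \<in> carrier_mat n n \<Longrightarrow> A * B \<in> carrier_mat n n"
  by auto

lemma diag_of_carrier [simp]: "diag_of n f \<in> carrier_mat n n" "dim_row (diag_of n f) = n" "dim_col (diag_of n f) = n"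
  by (auto simp: diag_of_def)

lemma transpose_diag_of [simp]: "transpose_mat (diag_of n f) = diag_of n f"
  by (auto simp: diag_of_def)

lemma diag_of_mult_left:
  assumes "A \<in> carrier_mat n m" "i < n" "j < m"
  shows "(diag_of n f * A) $$ (i,j) = f i * A $$ (i,j)"
  using assms by (simp add: diag_of_def scalar_prod_def if_distrib[of "\<lambda>x. x * _"] cong: if_cong)

lemma diag_of_mult_right:
  assumes "A \<in> carrier_mat m n" "i < m" "j < n"
  shows "(A * diag_of n f) $$ (i,j) = A $$ (i,j) * f j"
  using assms by (simp add: diag_of_def scalar_prod_def if_distrib[of "\<lambda>x. _ * x"] cong: if_cong)

lemma diag_of_mult: "diag_of n f * diag_of n g = diag_of n (\<lambda>i. f i * g i)"
  by (rule eq_matI) (auto simp: diag_of_mult_left[of _ n n] simp del: index_mult_mat(1), auto simp: diag_of_def)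

lemma orth_matD:
  assumes "orth_mat n P"
  shows "P \<in> carrier_mat n n" "P * transpose_mat P = 1\<^sub>m n" "transpose_mat P * P = 1\<^sub>m n"
  using assms mat_mult_left_right_inverse[of P n "transpose_mat P"] by (auto simp: orth_mat_def)

lemma orth_mat_mult: "orth_mat n P \<Longrightarrow> orth_mat n R \<Longrightarrow> orth_mat n (P * R)"
  and orth_mat_transpose: "orth_mat n P \<Longrightarrow> orth_mat n (transpose_mat P)"
proof -
  show "orth_mat n (P * R)" if "orth_mat n P" "orth_mat n R"
  proof -
    note P = orth_matD[OF that(1)] and R = orth_matD[OF that(2)]
    have "P * R * transpose_mat (P * R) = P * R * (transpose_mat R * transpose_mat P)"
      using P R by (simp add: transpose_mult[of _ n n _ n])
    also have "\<dots> = P * (R * transpose_mat R) * transpose_mat P"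
      using P(1) R(1) by (simp add: assoc_mult_mat[of _ n n _ n _ n])
    also have "\<dots> = 1\<^sub>m n" using P R by simp
    finally show ?thesis using P R by (auto simp: orth_mat_def)
  qed
  show "orth_mat n (transpose_mat P)" if "orth_mat n P"
    using orth_matD[OF that] by (simp add: orth_mat_def)
qed

lemma orth_mat_cancel:
  assumes "orth_mat n P" "A \<in> carrier_mat n m"
  shows "P * (transpose_mat P * A) = A" "transpose_mat P * (P * A) = A"
  using assms orth_matD[OF assms(1)] by (simp_all flip: assoc_mult_mat[of _ n n _ n _ m])

text \<open>The orthogonal matrix relating the two eigenbases intertwines the diagonals. Entrywise,
  a nonzero entry (i,j) forces the eigenvalues \<nu> i and \<mu> j to agree, so it also intertwines
  their images under \<open>f\<close>.\<close>

lemma spectral_calculus_unique: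
  fixes f :: "real \<Rightarrow> real"
  assumes P: "orth_mat n P" and R: "orth_mat n R"
    and eq: "P * diag_of n \<mu> * transpose_mat P = R * diag_of n \<nu> * transpose_mat R"
  shows "P * diag_of n (\<lambda>i. f (\<mu> i)) * transpose_mat P = R * diag_of n (\<lambda>i. f (\<nu> i)) * transpose_mat R"
proof -
  define O' where "O' = transpose_mat R * P"
  note Pc = orth_matD[OF P] and Rc = orth_matD[OF R]
  have O: "O' \<in> carrier_mat n n" using Pc Rc by (auto simp: O'_def)
  note as = assoc_mult_mat[of _ n n _ n _ n]
  have "O' * diag_of n \<mu> = transpose_mat R * (P * diag_of n \<mu> * transpose_mat P) * P"
    using Pc Rc by (simp add: O'_def as)
  also have "\<dots> = diag_of n \<nu> * O'"
    using Pc Rc unfolding eq by (simp add: O'_def as orth_mat_cancel[OF R, of _ n])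
  finally have com: "O' * diag_of n \<mu> = diag_of n \<nu> * O'" .
  have "O' * diag_of n (\<lambda>i. f (\<mu> i)) = diag_of n (\<lambda>i. f (\<nu> i)) * O'"
  proof (rule eq_matI)
    fix i j assume "i < dim_row (diag_of n (\<lambda>i. f (\<nu> i)) * O')" "j < dim_col (diag_of n (\<lambda>i. f (\<nu> i)) * O')"
    hence ij: "i < n" "j < n" using O by auto
    have "O' $$ (i,j) * \<mu> j = \<nu> i * O' $$ (i,j)"
      using arg_cong[OF com, of "\<lambda>A. A $$ (i,j)"] diag_of_mult_left[OF O ij] diag_of_mult_right[OF O ij] by simp
    hence "O' $$ (i,j) * f (\<mu> j) = f (\<nu> i) * O' $$ (i,j)" by (cases "O' $$ (i,j) = 0") auto
    thus "(O' * diag_of n (\<lambda>i. f (\<mu> i))) $$ (i,j) = (diag_of n (\<lambda>i. f (\<nu> i)) * O') $$ (i,j)"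
      using diag_of_mult_left[OF O ij] diag_of_mult_right[OF O ij] by simp
  qed (use O in auto)
  hence "R * (O' * diag_of n (\<lambda>i. f (\<mu> i))) * transpose_mat P = R * (diag_of n (\<lambda>i. f (\<nu> i)) * O') * transpose_mat P"
    by simp
  thus ?thesis using Pc Rc by (simp add: O'_def as orth_mat_cancel[OF R, of _ n])
qed

text \<open>By uniqueness of the spectral calculus, every diagonalisation yields the same
  pseudo-inverse root, so the choice in \<open>pinv_sqrt\<close> can be evaluated in any of
  them.\<close>

lemma pinv_sqrt_eq:
  assumes P: "orth_mat n P"
  shows "pinv_sqrt (P * diag_of n \<mu> * transpose_mat P) =
    P * diag_of n (\<lambda>i. if \<mu> i > 0 then 1 / sqrt (\<mu> i) else 0) * transpose_mat P"
proof -
  define S where "S = P * diag_of n \<mu> * transpose_mat P"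
  define R where "R = P * diag_of n (\<lambda>i. if \<mu> i > 0 then 1 / sqrt (\<mu> i) else 0) * transpose_mat P"
  have S: "dim_row S = n" using orth_matD[OF P] by (auto simp: S_def)
  have "pinv_sqrt S = R" unfolding pinv_sqrt_def S
  proof (rule some_equality)
    show "\<exists>P \<mu>. orth_mat n P \<and> S = P * diag_of n \<mu> * transpose_mat P \<and>
       R = P * diag_of n (\<lambda>i. if \<mu> i > 0 then 1 / sqrt (\<mu> i) else 0) * transpose_mat P"
      using P S_def R_def by blast
    fix R' assume "\<exists>P \<mu>. orth_mat n P \<and> S = P * diag_of n \<mu> * transpose_mat P \<and>
       R' = P * diag_of n (\<lambda>i. if \<mu> i > 0 then 1 / sqrt (\<mu> i) else 0) * transpose_mat P"
    then obtain P' \<mu>' where P': "orth_mat n P'" "P' * diag_of n \<mu>' * transpose_mat P' = S" and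
       R': "R' = P' * diag_of n (\<lambda>i. if \<mu>' i > 0 then 1 / sqrt (\<mu>' i) else 0) * transpose_mat P'"
      by auto
    show "R' = R" unfolding R' R_def
      using spectral_calculus_unique[OF P'(1) P P'(2)[unfolded S_def], of "\<lambda>x. if x > 0 then 1 / sqrt x else 0"] .
  qed
  thus ?thesis unfolding S_def R_def .
qed

text \<open>With the eigenbasis \<open>E\<close> fixed, matrix algebra reduces to pointwise algebra
  of the eigenvalue functions.\<close>

definition spec :: "nat \<Rightarrow> real mat \<Rightarrow> (nat \<Rightarrow> real) \<Rightarrow> real mat" where
  "spec n E f = E * diag_of n f * transpose_mat E"

context
  fixes n :: nat and E :: "real mat"
  assumes E: "orth_mat n E"
begin

lemma E_carrier [simp]: "E \<in> carrier_mat n n" "dim_row E = n" "dim_col E = n"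
  using orth_matD[OF E] by auto

lemma spec_carrier [simp]: "spec n E f \<in> carrier_mat n n" "dim_row (spec n E f) = n" "dim_col (spec n E f) = n"
  by (auto simp: spec_def)

lemma spec_mult: "spec n E f * spec n E g = spec n E (\<lambda>i. f i * g i)"
proof -
  have "spec n E f * spec n E g = E * (diag_of n f * diag_of n g) * transpose_mat E"
    by (simp add: spec_def assoc_mult_mat[of _ n n _ n _ n] orth_mat_cancel[OF E, of _ n])
  thus ?thesis by (simp add: spec_def diag_of_mult)
qed

lemma spec_transpose: "transpose_mat (spec n E f) = spec n E f"
  by (simp add: spec_def transpose_mult[of _ n n _ n] assoc_mult_mat[of _ n n _ n _ n])

lemma spec_entry:
  assumes "i < n" "j < n"
  shows "spec n E f $$ (i,j) = (\<Sum>k<n. f k * (E $$ (i,k) * E $$ (j,k)))"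
proof -
  have "(E * diag_of n f) $$ (i,k) = E $$ (i,k) * f k" if "k < n" for k
    using assms that by (intro diag_of_mult_right) auto
  moreover have "E * diag_of n f \<in> carrier_mat n n" by auto
  ultimately show ?thesis using assms mult_mat_entry[of "E * diag_of n f" n n "transpose_mat E" n i j]
    unfolding spec_def by (auto simp: mult_ac simp del: index_mult_mat(1) intro!: sum.cong)
qed

lemma spec_cong: "(\<And>i. i < n \<Longrightarrow> f i = g i) \<Longrightarrow> spec n E f = spec n E g"
  by (rule eq_matI) (auto simp: spec_entry)

lemma spec_add: "spec n E f + spec n E g = spec n E (\<lambda>i. f i + g i)"
  by (rule eq_matI) (auto simp: spec_entry ring_distribs sum.distrib)

lemma spec_diff: "spec n E f - spec n E g = spec n E (\<lambda>i. f i - g i)"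
  by (rule eq_matI) (auto simp: spec_entry ring_distribs sum_subtractf)

lemma spec_smult: "c \<cdot>\<^sub>m spec n E f = spec n E (\<lambda>i. c * f i)"
  by (rule eq_matI) (auto simp: spec_entry sum_distrib_left mult_ac)

lemma spec_one: "spec n E (\<lambda>_. 1) = 1\<^sub>m n"
proof -
  have "diag_of n (\<lambda>_. 1) = 1\<^sub>m n" by (auto simp: diag_of_def)
  thus ?thesis using orth_matD[OF E] by (simp add: spec_def)
qed

lemma outer_col:
  assumes "k < n"
  shows "outer (col E k) (col E k) = spec n E (\<lambda>i. of_bool (i = k))"
proof (rule eq_matI)
  fix i j assume "i < dim_row (spec n E (\<lambda>i. of_bool (i = k)))" "j < dim_col (spec n E (\<lambda>i. of_bool (i = k)))"
  hence ij: "i < n" "j < n" by auto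
  have "(\<Sum>l<n. of_bool (l = k) * (E $$ (i,l) * E $$ (j,l))) = (\<Sum>l<n. if l = k then E $$ (i,k) * E $$ (j,k) else 0)"
    by (intro sum.cong) auto
  thus "outer (col E k) (col E k) $$ (i,j) = spec n E (\<lambda>i. of_bool (i = k)) $$ (i,j)"
    using ij assms by (simp add: spec_entry outer_def)
qed (auto simp: outer_def)

text \<open>The inner product is the trace of a product of two commuting matrices, and the columns
  of \<open>E\<close> are unit vectors.\<close>

lemma frob_inner_spec: "frob_inner (spec n E f) (spec n E g) = (\<Sum>i<n. f i * g i)"
proof -
  have "frob_inner (spec n E f) (spec n E g) = (\<Sum>i<n. (spec n E f * transpose_mat (spec n E g)) $$ (i,i))"
    by (simp add: frob_inner_def scalar_prod_def lessThan_atLeast0)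
  also have "\<dots> = (\<Sum>i<n. \<Sum>k<n. f k * g k * (E $$ (i,k) * E $$ (i,k)))"
    unfolding spec_transpose spec_mult by (simp add: spec_entry)
  also have "\<dots> = (\<Sum>k<n. f k * g k * (\<Sum>i<n. E $$ (i,k) * E $$ (i,k)))"
    unfolding sum_distrib_left by (rule sum.swap)
  also have "\<dots> = (\<Sum>k<n. f k * g k)"
  proof (intro sum.cong refl)
    fix k assume "k \<in> {..<n}"
    hence k: "k < n" by simp
    have "(\<Sum>i<n. E $$ (i,k) * E $$ (i,k)) = (transpose_mat E * E) $$ (k,k)"
      using k by (simp add: scalar_prod_def lessThan_atLeast0)
    also have "\<dots> = 1" using orth_matD[OF E] k by simp
    finally show "f k * g k * (\<Sum>i<n. E $$ (i,k) * E $$ (i,k)) = f k * g k" by simp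
  qed
  finally show ?thesis .
qed

text \<open>The rotation \<open>U\<close> of the initialisation cancels, so \<open>M\<close> does
  not depend on it.\<close>

lemma spec_mult_orth_square:
  assumes U: "orth_mat n U"
  shows "spec n E f * U * transpose_mat (spec n E f * U) = spec n E (\<lambda>i. (f i)\<^sup>2)"
proof -
  have "spec n E f * U * transpose_mat (spec n E f * U) = spec n E f * (U * (transpose_mat U * transpose_mat (spec n E f)))"
    using orth_matD[OF U] by (simp add: transpose_mult[of _ n n _ n] assoc_mult_mat[of _ n n _ n _ n])
  also have "\<dots> = spec n E f * spec n E f" by (simp add: orth_mat_cancel[OF U, of _ n] spec_transpose)
  finally show ?thesis by (simp add: spec_mult power2_eq_square)
qed

text \<open>The Gram matrix is the conjugate by \<open>U\<close> of the one with eigenvalues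
  \<open>h i * h i\<close>. Its inverse root has eigenvalues 1/\<bar>h i\<bar>, and multiplying by
  \<open>h i\<close> leaves the sign. The Moore-Penrose convention at zero agrees with
  \<open>sgn 0 = 0\<close>.\<close>

lemma polar_spec_mult_orth:
  assumes U: "orth_mat n U"
  shows "polar (spec n E h * U) = spec n E (\<lambda>i. sgn (h i)) * U"
proof -
  note Uc = orth_matD[OF U]
  note as = assoc_mult_mat[of _ n n _ n _ n]
  define P where "P = transpose_mat U * E"
  have P: "orth_mat n P" unfolding P_def by (intro orth_mat_mult orth_mat_transpose U E)
  have PT: "transpose_mat P = transpose_mat E * U" using Uc by (simp add: P_def transpose_mult[of _ n n _ n])
  have conj: "transpose_mat U * spec n E f * U = P * diag_of n f * transpose_mat P" for f
    using Uc unfolding PT by (simp add: P_def spec_def as)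
  have "transpose_mat (spec n E h * U) * (spec n E h * U) = transpose_mat U * (spec n E h * spec n E h) * U"
    using Uc by (simp add: transpose_mult[of _ n n _ n] as spec_transpose)
  also have "\<dots> = P * diag_of n (\<lambda>i. h i * h i) * transpose_mat P" by (simp only: spec_mult conj)
  finally have "pinv_sqrt (transpose_mat (spec n E h * U) * (spec n E h * U)) =
     transpose_mat U * spec n E (\<lambda>i. if h i * h i > 0 then 1 / sqrt (h i * h i) else 0) * U"
    by (simp only: pinv_sqrt_eq[OF P] conj)
  hence "polar (spec n E h * U) = spec n E h * U * (transpose_mat U * spec n E (\<lambda>i. if h i * h i > 0 then 1 / sqrt (h i * h i) else 0) * U)"
    by (simp add: polar_def)
  also have "\<dots> = spec n E h * spec n E (\<lambda>i. if h i * h i > 0 then 1 / sqrt (h i * h i) else 0) * U"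
    using Uc by (simp add: as orth_mat_cancel[OF U, of _ n])
  also have "\<dots> = spec n E (\<lambda>i. h i * (if h i * h i > 0 then 1 / sqrt (h i * h i) else 0)) * U"
    by (simp only: spec_mult)
  also have "(\<lambda>i. h i * (if h i * h i > 0 then 1 / sqrt (h i * h i) else 0)) = (\<lambda>i. sgn (h i))"
    by (auto simp: fun_eq_iff sgn_real_def zero_less_mult_iff)
  finally show ?thesis .
qed

end

lemma frob_inner_outer:
  assumes "A \<in> carrier_mat n n" "dim_vec u = n"
  shows "frob_inner A (outer u u) = u \<bullet> (A *\<^sub>v u)"
  using assms by (auto simp: frob_inner_def outer_def scalar_prod_def lessThan_atLeast0 sum_distrib_left mult_ac intro!: sum.cong)

section \<open>An orthonormal basis with two prescribed vectors\<close>

text \<open>The reflection in the hyperplane orthogonal to x - y exchanges the unit vectors x and y,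
  and it fixes every vector having equal inner products with both. For x = y the identity
  serves.\<close>

lemma exists_householder:
  fixes x y :: "real Matrix.vec"
  assumes dim: "dim_vec x = n" "dim_vec y = n" and unit: "x \<bullet> x = 1" "y \<bullet> y = 1"
  shows "\<exists>H. orth_mat n H \<and> H *\<^sub>v x = y \<and> (\<forall>z. dim_vec z = n \<and> z \<bullet> x = z \<bullet> y \<longrightarrow> H *\<^sub>v z = z)"
proof (cases "x = y")
  case True
  thus ?thesis using dim by (intro exI[of _ "1\<^sub>m n"]) (auto simp: orth_mat_def intro!: one_mult_mat_vec carrier_vecI)
next
  case False
  define u where "u = (\<lambda>i. x $ i - y $ i)"
  define s where "s = (\<Sum>i<n. u i * u i)"
  define H where "H = mat n n (\<lambda>(i,j). of_bool (i = j) - 2 / s * (u i * u j))"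
  obtain i where i: "i < n" "u i \<noteq> 0" using False dim by (auto simp: u_def vec_eq_iff)
  have "s > 0" unfolding s_def by (rule sum_pos2[of _ i]) (use i in \<open>auto simp: zero_less_mult_iff\<close>)
  have sp: "a \<bullet> b = (\<Sum>i<n. a $ i * b $ i)" if "dim_vec b = n" for a b :: "real Matrix.vec"
    using that by (simp add: scalar_prod_def lessThan_atLeast0)
  have s: "s = 2 - 2 * (x \<bullet> y)"
  proof -
    have "s = (\<Sum>i<n. x $ i * x $ i) + (\<Sum>i<n. y $ i * y $ i) - 2 * (\<Sum>i<n. x $ i * y $ i)"
      by (simp add: s_def u_def algebra_simps sum.distrib sum_subtractf sum_distrib_left)
    thus ?thesis using unit dim by (simp add: sp)
  qed
  have Hz: "(H *\<^sub>v z) $ i = z $ i - 2 / s * u i * (z \<bullet> x - z \<bullet> y)" if "i < n" "dim_vec z = n" for z i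
  proof -
    have "(H *\<^sub>v z) $ i = (\<Sum>j<n. (of_bool (i = j) - 2 / s * (u i * u j)) * z $ j)"
      using that by (simp add: H_def scalar_prod_def lessThan_atLeast0)
    also have "\<dots> = (\<Sum>j<n. (if j = i then z $ i else 0) - 2 / s * u i * (z $ j * x $ j - z $ j * y $ j))"
      by (intro sum.cong) (auto simp: u_def algebra_simps diff_divide_distrib)
    also have "\<dots> = (\<Sum>j<n. if j = i then z $ i else 0) - 2 / s * u i * (z \<bullet> x - z \<bullet> y)"
      unfolding sp[OF dim(1)] sp[OF dim(2)] sum_subtractf[symmetric] sum_distrib_left ..
    also have "\<dots> = z $ i - 2 / s * u i * (z \<bullet> x - z \<bullet> y)" using that by simp
    finally show ?thesis .
  qed
  have "H * transpose_mat H = 1\<^sub>m n"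
  proof (rule eq_matI)
    fix i j assume "i < dim_row (1\<^sub>m n :: real mat)" "j < dim_col (1\<^sub>m n :: real mat)"
    hence ij: "i < n" "j < n" by auto
    have "(H * transpose_mat H) $$ (i,j) = (\<Sum>k<n. (of_bool (i = k) - 2 / s * (u i * u k)) * (of_bool (j = k) - 2 / s * (u j * u k)))"
      using ij by (simp add: H_def scalar_prod_def lessThan_atLeast0)
    also have "\<dots> = (\<Sum>k<n. (if k = i then of_bool (i = j) - 2 / s * (u i * u j) else 0)
        - (if k = j then 2 / s * (u i * u j) else 0) + (2 / s)\<^sup>2 * (u i * u j) * (u k * u k))"
      by (intro sum.cong) (auto simp: algebra_simps power2_eq_square)
    also have "\<dots> = of_bool (i = j) - 2 * (2 / s * (u i * u j)) + (2 / s)\<^sup>2 * (u i * u j) * s"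
      using ij by (simp add: sum.distrib sum_subtractf s_def flip: sum_distrib_left)
    also have "\<dots> = of_bool (i = j)" using \<open>s > 0\<close> by (simp add: power2_eq_square)
    finally show "(H * transpose_mat H) $$ (i,j) = 1\<^sub>m n $$ (i,j)" using ij by simp
  qed (auto simp: H_def)
  hence "orth_mat n H" by (auto simp: orth_mat_def H_def)
  moreover have "H *\<^sub>v x = y"
  proof (rule eq_vecI)
    fix i assume "i < dim_vec y"
    hence "(H *\<^sub>v x) $ i = x $ i - u i * (2 * (1 - x \<bullet> y) / s)"
      using Hz[of i x] dim unit by simp
    also have "2 * (1 - x \<bullet> y) / s = 1" using s \<open>s > 0\<close> by simp
    finally show "(H *\<^sub>v x) $ i = y $ i" by (simp add: u_def)
  qed (use dim in \<open>auto simp: H_def\<close>)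
  moreover have "H *\<^sub>v z = z" if "dim_vec z = n" "z \<bullet> x = z \<bullet> y" for z
    by (rule eq_vecI) (use Hz[of _ z] that in \<open>auto simp: H_def\<close>)
  ultimately show ?thesis by blast
qed

lemma col_eq_mult_unit_vec:
  fixes A :: "real mat"
  assumes "A \<in> carrier_mat m n" "j < n"
  shows "col A j = A *\<^sub>v unit_vec n j"
  using assms by (intro eq_vecI) (auto simp: scalar_prod_right_unit)

text \<open>A first reflection \<open>H\<close> sends the first unit vector to \<open>w\<close>. The
  pullback of \<open>v\<close> is orthogonal to that unit vector, so a second reflection
  \<open>K\<close> sends the second unit vector to the pullback and fixes the first; the product
  \<open>H * K\<close> has the two columns.\<close>

lemma exists_orth_mat_two_cols:
  fixes w v :: "real Matrix.vec"
  assumes n: "n \<ge> 2" and dim: "dim_vec w = n" "dim_vec v = n"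
    and orth: "w \<bullet> w = 1" "v \<bullet> v = 1" "v \<bullet> w = 0"
  shows "\<exists>E. orth_mat n E \<and> col E 0 = w \<and> col E 1 = v"
proof -
  have e: "unit_vec n 0 \<bullet> unit_vec n 0 = (1::real)" "unit_vec n 1 \<bullet> unit_vec n 1 = (1::real)"
    "unit_vec n 0 \<bullet> unit_vec n 1 = (0::real)" using n by auto
  obtain H where H: "orth_mat n H" "H *\<^sub>v unit_vec n 0 = w"
    using exists_householder[of "unit_vec n 0" n w] e dim orth by auto
  note Hc = orth_matD[OF H(1)]
  define v' where "v' = transpose_mat H *\<^sub>v v"
  have v': "dim_vec v' = n" using Hc by (auto simp: v'_def)
  have Hv': "H *\<^sub>v v' = v"
  proof -
    have v: "v \<in> carrier_vec n" using dim(2) by (rule carrier_vecI)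
    have "H *\<^sub>v v' = H * transpose_mat H *\<^sub>v v"
      unfolding v'_def using Hc v by (intro assoc_mult_mat_vec[symmetric]) auto
    thus ?thesis using Hc v by simp
  qed
  have adj: "(transpose_mat H *\<^sub>v v) \<bullet> z = v \<bullet> (H *\<^sub>v z)" if "dim_vec z = n" for z
    using transpose_vec_mult_scalar[of H n n z v] Hc that dim
    by (metis carrier_vecI comm_scalar_prod mult_mat_vec_carrier transpose_carrier_mat)
  have v'1: "v' \<bullet> v' = 1" using adj[OF v'] Hv' orth by (simp add: v'_def)
  have "v' \<bullet> unit_vec n 0 = 0" using adj[of "unit_vec n 0"] H(2) orth by (simp add: v'_def)
  hence v'0: "unit_vec n 0 \<bullet> v' = 0" using v' by (metis carrier_vecI comm_scalar_prod unit_vec_carrier)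
  obtain K where K: "orth_mat n K" "K *\<^sub>v unit_vec n 1 = v'"
    "\<And>z. dim_vec z = n \<Longrightarrow> z \<bullet> unit_vec n 1 = z \<bullet> v' \<Longrightarrow> K *\<^sub>v z = z"
    using exists_householder[of "unit_vec n 1" n v'] e v' v'1 by auto
  have K0: "K *\<^sub>v unit_vec n 0 = unit_vec n 0" by (rule K(3)) (use e v'0 in auto)
  note Kc = orth_matD[OF K(1)]
  have col: "col (H * K) i = H *\<^sub>v (K *\<^sub>v unit_vec n i)" if "i < n" for i
  proof -
    have "col (H * K) i = (H * K) *\<^sub>v unit_vec n i" using that Hc Kc by (intro col_eq_mult_unit_vec[of _ n n]) auto
    thus ?thesis using Hc Kc by (simp add: assoc_mult_mat_vec[of _ n n _ n])
  qed
  show ?thesis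
    using col[of 0] col[of 1] n H(2) Hv' K(2) K0 orth_mat_mult[OF H(1) K(1)] by (intro exI[of _ "H * K"]) auto
qed

section \<open>The gradient\<close>

lemma sum_swap2:
  fixes f :: "nat \<Rightarrow> nat \<Rightarrow> nat \<Rightarrow> nat \<Rightarrow> real"
  shows "(\<Sum>i<d. \<Sum>j<d. \<Sum>k<d. \<Sum>l<d. f i j k l) = (\<Sum>k<d. \<Sum>l<d. \<Sum>i<d. \<Sum>j<d. f i j k l)"
proof -
  have 1: "(\<Sum>j<d. \<Sum>k<d. \<Sum>l<d. g j k l) = (\<Sum>k<d. \<Sum>l<d. \<Sum>j<d. g j k l)" for g :: "nat \<Rightarrow> nat \<Rightarrow> nat \<Rightarrow> real"
    by (rule trans[OF sum.swap]) (intro sum.cong refl sum.swap)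
  have "(\<Sum>i<d. \<Sum>j<d. \<Sum>k<d. \<Sum>l<d. f i j k l) = (\<Sum>i<d. \<Sum>k<d. \<Sum>l<d. \<Sum>j<d. f i j k l)"
    by (intro sum.cong refl 1)
  also have "\<dots> = (\<Sum>k<d. \<Sum>l<d. \<Sum>i<d. \<Sum>j<d. f i j k l)" by (rule 1)
  finally show ?thesis .
qed

text \<open>Contracting the Isserlis kernel with a symmetric matrix N gives tr(QN) Q + 2 QNQ, read
  entrywise; the two crossed pairings coincide by symmetry.\<close>

lemma isserlis_contraction:
  fixes Q N :: "nat \<Rightarrow> nat \<Rightarrow> real"
  assumes Q: "\<And>i j. i < d \<Longrightarrow> j < d \<Longrightarrow> Q i j = Q j i" and N: "\<And>i j. N i j = N j i"
    and ij: "i < d" "j < d"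
  shows "(\<Sum>k<d. \<Sum>l<d. N k l * (Q i j * Q k l + Q i k * Q j l + Q i l * Q j k)) =
    Q i j * (\<Sum>k<d. \<Sum>l<d. Q k l * N k l) + 2 * (\<Sum>l<d. (\<Sum>k<d. Q i k * N k l) * Q l j)"
proof -
  have 1: "(\<Sum>k<d. \<Sum>l<d. N k l * (Q i k * Q j l)) = (\<Sum>l<d. (\<Sum>k<d. Q i k * N k l) * Q l j)"
    by (subst sum.swap) (auto simp: sum_distrib_left Q ij mult_ac intro!: sum.cong)
  have 2: "(\<Sum>k<d. \<Sum>l<d. N k l * (Q i l * Q j k)) = (\<Sum>l<d. (\<Sum>k<d. Q i k * N k l) * Q l j)"
    by (auto simp: sum_distrib_left Q[OF _ ij(2)] N mult_ac intro!: sum.cong)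
  have 3: "(\<Sum>k<d. \<Sum>l<d. N k l * (Q i j * Q k l)) = Q i j * (\<Sum>k<d. \<Sum>l<d. Q k l * N k l)"
    by (simp add: sum_distrib_left mult_ac)
  show ?thesis unfolding ring_distribs sum.distrib 1 2 3 by simp
qed

text \<open>The loss is quadratic in N, which gives a first factor 2; the derivative of N is a
  symmetrised rank-one term paired with the symmetric matrix \<open>F\<close>, which gives a second.
  The minus sign comes from N being minus \<Delta>.\<close>

lemma loss_directional_derivative:
  fixes Q :: "nat \<Rightarrow> nat \<Rightarrow> real" and w :: "nat \<Rightarrow> real" and V :: "nat \<Rightarrow> nat \<Rightarrow> real"
  assumes Q: "\<And>i j. i < d \<Longrightarrow> j < d \<Longrightarrow> Q i j = Q j i" and p: "p < d" and r: "r < m"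
  defines "N \<equiv> \<lambda>t i j. w i * w j - (\<Sum>q<m. (V i q + t * of_bool (i = p \<and> q = r)) * (V j q + t * of_bool (j = p \<and> q = r)))"
  shows "((\<lambda>t. s + (\<Sum>i<d. \<Sum>j<d. \<Sum>k<d. \<Sum>l<d. N t i j * N t k l * (Q i j * Q k l + Q i k * Q j l + Q i l * Q j k)))
    has_real_derivative
      - 4 * (\<Sum>j<d. (Q p j * (\<Sum>k<d. \<Sum>l<d. Q k l * N 0 k l) + 2 * (\<Sum>l<d. (\<Sum>k<d. Q p k * N 0 k l) * Q l j)) * V j r)) (at 0)"
proof -
  define K where "K = (\<lambda>i j k l. Q i j * Q k l + Q i k * Q j l + Q i l * Q j k)"
  define D where "D = (\<lambda>i j. - (of_bool (i = p) * V j r + of_bool (j = p) * V i r))"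
  define F where "F = (\<lambda>i j. Q i j * (\<Sum>k<d. \<Sum>l<d. Q k l * N 0 k l) + 2 * (\<Sum>l<d. (\<Sum>k<d. Q i k * N 0 k l) * Q l j))"
  have Nsym: "N t i j = N t j i" for t i j by (simp add: N_def mult.commute)
  have DN: "((\<lambda>t. N t i j) has_real_derivative D i j) (at 0)" for i j
  proof -
    have "((\<lambda>t. N t i j) has_real_derivative
       - (\<Sum>q<m. of_bool (i = p \<and> q = r) * V j q + V i q * of_bool (j = p \<and> q = r))) (at 0)"
      unfolding N_def by (auto intro!: derivative_eq_intros sum.cong)
    also have "(\<Sum>q<m. of_bool (i = p \<and> q = r) * V j q + V i q * of_bool (j = p \<and> q = r)) =
       (\<Sum>q<m. if q = r then of_bool (i = p) * V j r + of_bool (j = p) * V i r else 0)"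
      by (intro sum.cong) auto
    also have "- \<dots> = D i j" using r by (simp add: D_def)
    finally show ?thesis .
  qed
  have "((\<lambda>t. s + (\<Sum>i<d. \<Sum>j<d. \<Sum>k<d. \<Sum>l<d. N t i j * N t k l * K i j k l)) has_real_derivative
     0 + (\<Sum>i<d. \<Sum>j<d. \<Sum>k<d. \<Sum>l<d. (D i j * N 0 k l + D k l * N 0 i j) * K i j k l)) (at 0)"
    by (intro DERIV_add DERIV_const DERIV_sum DERIV_cmult_right DERIV_mult DN)
  also have "0 + (\<Sum>i<d. \<Sum>j<d. \<Sum>k<d. \<Sum>l<d. (D i j * N 0 k l + D k l * N 0 i j) * K i j k l) =
     (\<Sum>i<d. \<Sum>j<d. \<Sum>k<d. \<Sum>l<d. D i j * N 0 k l * K i j k l) +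
     (\<Sum>i<d. \<Sum>j<d. \<Sum>k<d. \<Sum>l<d. D k l * N 0 i j * K i j k l)"
    by (simp add: ring_distribs sum.distrib)
  \<comment> \<open>Exchanging the index pairs (i,j) and (k,l), under which the kernel is symmetric,
    makes the two product-rule terms equal.\<close>
  also have "(\<Sum>i<d. \<Sum>j<d. \<Sum>k<d. \<Sum>l<d. D k l * N 0 i j * K i j k l) =
     (\<Sum>i<d. \<Sum>j<d. \<Sum>k<d. \<Sum>l<d. D i j * N 0 k l * K k l i j)"
    by (rule sum_swap2)
  also have "\<dots> = (\<Sum>i<d. \<Sum>j<d. \<Sum>k<d. \<Sum>l<d. D i j * N 0 k l * K i j k l)"
    by (intro sum.cong refl) (auto simp: K_def Q mult_ac)
  also have "(\<Sum>i<d. \<Sum>j<d. \<Sum>k<d. \<Sum>l<d. D i j * N 0 k l * K i j k l) =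
     (\<Sum>i<d. \<Sum>j<d. D i j * (\<Sum>k<d. \<Sum>l<d. N 0 k l * K i j k l))"
    by (simp add: sum_distrib_left mult_ac)
  also have "\<dots> = (\<Sum>i<d. \<Sum>j<d. D i j * F i j)"
    unfolding K_def F_def by (intro sum.cong refl arg_cong2[where f = times] isserlis_contraction Q Nsym) auto
  also have "\<dots> = - (\<Sum>i<d. \<Sum>j<d. of_bool (i = p) * V j r * F i j) - (\<Sum>i<d. \<Sum>j<d. of_bool (j = p) * V i r * F i j)"
    by (simp add: D_def ring_distribs sum.distrib sum_negf sum_subtractf)
  also have "(\<Sum>i<d. \<Sum>j<d. of_bool (i = p) * V j r * F i j) = (\<Sum>j<d. F p j * V j r)"
  proof -
    have "(\<Sum>i<d. \<Sum>j<d. of_bool (i = p) * V j r * F i j) = (\<Sum>j<d. \<Sum>i<d. if i = p then F p j * V j r else 0)"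
      by (subst sum.swap) (auto intro!: sum.cong)
    thus ?thesis using p by simp
  qed
  also have "(\<Sum>i<d. \<Sum>j<d. of_bool (j = p) * V i r * F i j) = (\<Sum>j<d. F j p * V j r)"
  proof -
    have "(\<Sum>i<d. \<Sum>j<d. of_bool (j = p) * V i r * F i j) = (\<Sum>i<d. \<Sum>j<d. if j = p then F i p * V i r else 0)"
      by (intro sum.cong refl) auto
    thus ?thesis using p by simp
  qed
  also have "\<dots> = (\<Sum>j<d. F p j * V j r)"
  proof (intro sum.cong refl arg_cong2[where f = times])
    fix j assume "j \<in> {..<d}"
    hence j: "j < d" by simp
    have "(\<Sum>l<d. (\<Sum>k<d. Q j k * N 0 k l) * Q l p) = (\<Sum>k<d. \<Sum>l<d. Q j k * N 0 k l * Q l p)"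
      by (subst sum.swap) (simp add: sum_distrib_right)
    also have "\<dots> = (\<Sum>l<d. (\<Sum>k<d. Q p k * N 0 k l) * Q l j)"
      using j p by (auto simp: sum_distrib_left Q[of j] Q[of p] Nsym[of 0] mult_ac intro!: sum.cong)
    finally show "F j p = F p j" unfolding F_def using Q[OF j p] by simp
  qed
  finally show ?thesis unfolding K_def F_def by (simp add: algebra_simps)
qed

text \<open>The entrywise derivative is rewritten with \<Delta> in place of N, which reverses the
  sign, and the sums are recognised as matrix products.\<close>

lemma grad_loss:
  assumes Q: "\<exists>A. A \<in> carrier_mat d d \<and> A * transpose_mat A = Q"
    and w: "dim_vec w = d" and W: "W \<in> carrier_mat d m"
  defines "\<Delta> \<equiv> W * transpose_mat W - outer w w"
  shows "grad (loss d Q w \<sigma>) W = (4 * frob_inner Q \<Delta>) \<cdot>\<^sub>m (Q * W) + 8 \<cdot>\<^sub>m (Q * \<Delta> * Q * W)"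
proof -
  obtain A where A: "A \<in> carrier_mat d d" "A * transpose_mat A = Q" using Q by auto
  hence Qc: "Q \<in> carrier_mat d d" by auto
  have sym: "Q $$ (i,j) = Q $$ (j,i)" if "i < d" "j < d" for i j
    unfolding A(2)[symmetric] using A(1) that by (simp add: scalar_prod_def mult.commute)
  have \<Delta>c: "\<Delta> \<in> carrier_mat d d" using W w by (auto simp: \<Delta>_def outer_def)
  define N where "N = (\<lambda>i j. w $ i * w $ j - (\<Sum>q<m. W $$ (i,q) * W $$ (j,q)))"
  have \<Delta>: "\<Delta> $$ (i,j) = - N i j" if "i < d" "j < d" for i j
    using W w that by (auto simp: \<Delta>_def N_def outer_def scalar_prod_def lessThan_atLeast0)
  have fr: "frob_inner Q \<Delta> = - (\<Sum>k<d. \<Sum>l<d. Q $$ (k,l) * N k l)"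
    using Qc by (simp add: frob_inner_def \<Delta> sum_negf)
  have QDQ: "(Q * \<Delta> * Q) $$ (p,j) = - (\<Sum>l<d. (\<Sum>k<d. Q $$ (p,k) * N k l) * Q $$ (l,j))" if "p < d" "j < d" for p j
  proof -
    have "(Q * \<Delta> * Q) $$ (p,j) = - (\<Sum>k<d. Q $$ (p,k) * (\<Sum>l<d. N k l * Q $$ (l,j)))"
      using Qc \<Delta>c that by (simp add: scalar_prod_def lessThan_atLeast0[symmetric] \<Delta> sum_negf)
    also have "(\<Sum>k<d. Q $$ (p,k) * (\<Sum>l<d. N k l * Q $$ (l,j))) = (\<Sum>l<d. (\<Sum>k<d. Q $$ (p,k) * N k l) * Q $$ (l,j))"
      unfolding sum_distrib_left sum_distrib_right mult.assoc by (rule sum.swap)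
    finally show ?thesis .
  qed
  show ?thesis
  proof (rule eq_matI)
    show "dim_row (grad (loss d Q w \<sigma>) W) = dim_row ((4 * frob_inner Q \<Delta>) \<cdot>\<^sub>m (Q * W) + 8 \<cdot>\<^sub>m (Q * \<Delta> * Q * W))"
      "dim_col (grad (loss d Q w \<sigma>) W) = dim_col ((4 * frob_inner Q \<Delta>) \<cdot>\<^sub>m (Q * W) + 8 \<cdot>\<^sub>m (Q * \<Delta> * Q * W))"
      using W Qc by (auto simp: grad_def)
    fix p r
    assume "p < dim_row ((4 * frob_inner Q \<Delta>) \<cdot>\<^sub>m (Q * W) + 8 \<cdot>\<^sub>m (Q * \<Delta> * Q * W))"
      "r < dim_col ((4 * frob_inner Q \<Delta>) \<cdot>\<^sub>m (Q * W) + 8 \<cdot>\<^sub>m (Q * \<Delta> * Q * W))"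
    hence p: "p < d" and r: "r < m" using W Qc by auto
    let ?W = "\<lambda>t. W + t \<cdot>\<^sub>m unit_entry d m p r"
    define N' where "N' = (\<lambda>t i j. w $ i * w $ j - (\<Sum>q<m. (W $$ (i,q) + t * of_bool (i = p \<and> q = r)) * (W $$ (j,q) + t * of_bool (j = p \<and> q = r))))"
    have L: "loss d Q w \<sigma> (?W t) = \<sigma>\<^sup>2 + (\<Sum>i<d. \<Sum>j<d. \<Sum>k<d. \<Sum>l<d. N' t i j * N' t k l *
      (Q $$ (i,j) * Q $$ (k,l) + Q $$ (i,k) * Q $$ (j,l) + Q $$ (i,l) * Q $$ (j,k)))" for t
    proof -
      have "?W t \<in> carrier_mat d m" using W by (auto simp: unit_entry_def)
      moreover have "(w $ i * w $ j - (\<Sum>q<m. ?W t $$ (i,q) * ?W t $$ (j,q))) = N' t i j" if "i < d" "j < d" for i j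
        using W that p r by (auto simp: N'_def unit_entry_def of_bool_def intro!: sum.cong)
      ultimately show ?thesis using loss_closed_form[OF Q w, of "?W t" m \<sigma>] by simp
    qed
    have "grad (loss d Q w \<sigma>) W $$ (p,r) = deriv (\<lambda>t. loss d Q w \<sigma> (?W t)) 0"
      using W p r by (simp add: grad_def)
    also have "\<dots> = - 4 * (\<Sum>j<d. (Q $$ (p,j) * (\<Sum>k<d. \<Sum>l<d. Q $$ (k,l) * N' 0 k l)
        + 2 * (\<Sum>l<d. (\<Sum>k<d. Q $$ (p,k) * N' 0 k l) * Q $$ (l,j))) * W $$ (j,r))"
      unfolding L unfolding N'_def
      by (rule DERIV_imp_deriv, rule loss_directional_derivative[where Q = "\<lambda>i j. Q $$ (i,j)" and w = "\<lambda>i. w $ i" and V = "\<lambda>i j. W $$ (i,j)", OF sym p r])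
    also have "N' 0 = N" by (simp add: N'_def N_def)
    also have "- 4 * (\<Sum>j<d. (Q $$ (p,j) * (\<Sum>k<d. \<Sum>l<d. Q $$ (k,l) * N k l)
        + 2 * (\<Sum>l<d. (\<Sum>k<d. Q $$ (p,k) * N k l) * Q $$ (l,j))) * W $$ (j,r)) =
        4 * frob_inner Q \<Delta> * (\<Sum>j<d. Q $$ (p,j) * W $$ (j,r)) + 8 * (\<Sum>j<d. (Q * \<Delta> * Q) $$ (p,j) * W $$ (j,r))"
    proof -
      have "(\<Sum>j<d. (Q $$ (p,j) * (\<Sum>k<d. \<Sum>l<d. Q $$ (k,l) * N k l)
        + 2 * (\<Sum>l<d. (\<Sum>k<d. Q $$ (p,k) * N k l) * Q $$ (l,j))) * W $$ (j,r)) =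
        (\<Sum>j<d. - frob_inner Q \<Delta> * (Q $$ (p,j) * W $$ (j,r)) - 2 * ((Q * \<Delta> * Q) $$ (p,j) * W $$ (j,r)))"
        by (intro sum.cong refl) (simp add: QDQ[OF p] fr algebra_simps)
      also have "\<dots> = - frob_inner Q \<Delta> * (\<Sum>j<d. Q $$ (p,j) * W $$ (j,r)) - 2 * (\<Sum>j<d. (Q * \<Delta> * Q) $$ (p,j) * W $$ (j,r))"
        by (simp only: sum_subtractf sum_distrib_left)
      finally show ?thesis by simp
    qed
    also have "(\<Sum>j<d. Q $$ (p,j) * W $$ (j,r)) = (Q * W) $$ (p,r)"
      using Qc W p r by (simp add: scalar_prod_def lessThan_atLeast0)
    also have "(\<Sum>j<d. (Q * \<Delta> * Q) $$ (p,j) * W $$ (j,r)) = (Q * \<Delta> * Q * W) $$ (p,r)"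
    proof -
      have "Q * \<Delta> * Q \<in> carrier_mat d d" using Qc \<Delta>c by auto
      from mult_mat_entry[OF this W p r] show ?thesis by simp
    qed
    finally show "grad (loss d Q w \<sigma>) W $$ (p,r) = ((4 * frob_inner Q \<Delta>) \<cdot>\<^sub>m (Q * W) + 8 \<cdot>\<^sub>m (Q * \<Delta> * Q * W)) $$ (p,r)"
      using Qc \<Delta>c W p r by simp
  qed
qed

section \<open>The trajectory\<close>

text \<open>Eigenvalues of Q: index 0 stands for the direction of the signal, index 1 for
  \<open>v\<close>, the others for the bulk.\<close>

definition spike :: "real \<Rightarrow> nat \<Rightarrow> real" where
  "spike lam i = (if i = 1 then 1 + lam else 1)"

text \<open>This is tr(Q \<Delta>), the quantity called \<open>\<tau>\<close> in the sign
  dynamics.\<close>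

definition residual :: "nat \<Rightarrow> real \<Rightarrow> (nat \<Rightarrow> real) \<Rightarrow> real" where
  "residual d lam \<mu> = (\<Sum>i<d. spike lam i * ((\<mu> i)\<^sup>2 - of_bool (i = 0)))"

text \<open>Eigenvalues of 4 (2 Q \<Delta> Q + tr(Q \<Delta>) Q) S, where S has eigenvalues
  \<mu>.\<close>

definition grad_ev :: "nat \<Rightarrow> real \<Rightarrow> (nat \<Rightarrow> real) \<Rightarrow> nat \<Rightarrow> real" where
  "grad_ev d lam \<mu> i = 4 * spike lam i * (2 * spike lam i * ((\<mu> i)\<^sup>2 - of_bool (i = 0)) + residual d lam \<mu>) * \<mu> i"

primrec iterate_ev :: "nat \<Rightarrow> real \<Rightarrow> real \<Rightarrow> real \<Rightarrow> nat \<Rightarrow> nat \<Rightarrow> real" where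
  "iterate_ev d lam \<eta> \<theta> 0 = (\<lambda>_. \<theta>)"
| "iterate_ev d lam \<eta> \<theta> (Suc k) =
    (\<lambda>i. iterate_ev d lam \<eta> \<theta> k i - \<eta> * sgn (grad_ev d lam (iterate_ev d lam \<eta> \<theta> k) i))"

text \<open>All bulk directions start equal and obey the same recursion, so index 2 can represent
  them.\<close>

lemma iterate_ev_bulk: "i \<ge> 2 \<Longrightarrow> iterate_ev d lam \<eta> \<theta> k i = iterate_ev d lam \<eta> \<theta> k 2"
  by (induction k) (auto simp: grad_ev_def spike_def)

lemma sum_split_two:
  fixes f :: "nat \<Rightarrow> real"
  assumes "d \<ge> 2" "\<And>i. i \<ge> 2 \<Longrightarrow> f i = f 2"
  shows "(\<Sum>i<d. f i) = f 0 + f 1 + (real d - 2) * f 2"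
proof -
  have "{..<d} = {0,1} \<union> {2..<d}" using assms(1) by auto
  hence "(\<Sum>i<d. f i) = (\<Sum>i\<in>{0,1}. f i) + (\<Sum>i\<in>{2..<d}. f i)"
    by (simp add: sum.union_disjoint)
  also have "(\<Sum>i\<in>{2..<d}. f i) = (\<Sum>i\<in>{2..<d}. f 2)" by (intro sum.cong refl assms(2)) auto
  finally show ?thesis using assms(1) by (simp add: of_nat_diff)
qed

lemma residual_iterate_ev:
  fixes d k :: nat and lam \<eta> \<theta> :: real
  assumes "d \<ge> 2"
  defines "\<mu> \<equiv> iterate_ev d lam \<eta> \<theta> k"
  shows "residual d lam \<mu> = (\<mu> 0)\<^sup>2 - 1 + (1 + lam) * (\<mu> 1)\<^sup>2 + (real d - 2) * (\<mu> 2)\<^sup>2"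
proof -
  have "spike lam i * ((\<mu> i)\<^sup>2 - of_bool (i = 0)) = spike lam 2 * ((\<mu> 2)\<^sup>2 - of_bool ((2::nat) = 0))" if "i \<ge> 2" for i
    using iterate_ev_bulk[OF that, of d lam \<eta> \<theta> k] that by (simp add: spike_def \<mu>_def)
  from sum_split_two[OF assms(1), of "\<lambda>i. spike lam i * ((\<mu> i)\<^sup>2 - of_bool (i = 0))", OF this] show ?thesis unfolding residual_def by (simp add: spike_def)
qed

lemma sgn_grad_ev:
  assumes "lam \<ge> 0"
  shows "sgn (grad_ev d lam \<mu> i) = sgn (2 * spike lam i * ((\<mu> i)\<^sup>2 - of_bool (i = 0)) + residual d lam \<mu>) * sgn (\<mu> i)"
  using assms by (simp add: grad_ev_def sgn_mult spike_def)

context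
  fixes d :: nat and E U :: "real mat" and w v :: "real Matrix.vec" and lam :: real
  assumes E: "orth_mat d E" "col E 0 = w" "col E 1 = v" and U: "orth_mat d U"
    and d: "d \<ge> 2" and lam: "lam \<ge> 0"
begin

lemma outer_spec: "outer w w = spec d E (\<lambda>i. of_bool (i = 0))" "outer v v = spec d E (\<lambda>i. of_bool (i = 1))"
  using outer_col[OF E(1), of 0] outer_col[OF E(1), of 1] E d by auto

lemma cov_spec: "1\<^sub>m d + lam \<cdot>\<^sub>m outer v v = spec d E (spike lam)"
  unfolding outer_spec spec_one[OF E(1), symmetric] spec_smult[OF E(1)] spec_add[OF E(1)]
  by (rule spec_cong[OF E(1)]) (simp add: spike_def)

lemma bulk_spec: "1\<^sub>m d - outer w w - outer v v = spec d E (\<lambda>i. of_bool (i \<ge> 2))"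
  unfolding outer_spec spec_one[OF E(1), symmetric] spec_diff[OF E(1)]
  by (rule spec_cong[OF E(1)]) (auto simp: of_bool_def)

lemma cov_factor: "\<exists>A. A \<in> carrier_mat d d \<and> A * transpose_mat A = 1\<^sub>m d + lam \<cdot>\<^sub>m outer v v"
proof (intro exI conjI)
  show "spec d E (\<lambda>i. sqrt (spike lam i)) * transpose_mat (spec d E (\<lambda>i. sqrt (spike lam i))) = 1\<^sub>m d + lam \<cdot>\<^sub>m outer v v"
    unfolding cov_spec spec_transpose[OF E(1)] spec_mult[OF E(1)]
    by (rule spec_cong[OF E(1)]) (use lam in \<open>auto simp: spike_def\<close>)
qed (simp add: E(1))

lemma grad_loss_spec:
  "grad (loss d (1\<^sub>m d + lam \<cdot>\<^sub>m outer v v) w \<sigma>) (spec d E \<mu> * U) = spec d E (grad_ev d lam \<mu>) * U"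
proof -
  note Uc = orth_matD[OF U]
  note sc = spec_carrier[OF E(1)]
  have w: "dim_vec w = d" using E by (auto simp: orth_mat_def)
  have W: "spec d E \<mu> * U \<in> carrier_mat d d" using Uc sc by simp
  let ?\<delta> = "\<lambda>i. (\<mu> i)\<^sup>2 - of_bool (i = 0)"
  have \<Delta>: "spec d E \<mu> * U * transpose_mat (spec d E \<mu> * U) - outer w w = spec d E ?\<delta>"
    unfolding spec_mult_orth_square[OF E(1) U] outer_spec spec_diff[OF E(1)] ..
  have f: "frob_inner (spec d E (spike lam)) (spec d E ?\<delta>) = residual d lam \<mu>"
    unfolding frob_inner_spec[OF E(1)] residual_def ..
  have "grad (loss d (1\<^sub>m d + lam \<cdot>\<^sub>m outer v v) w \<sigma>) (spec d E \<mu> * U) =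
    (4 * residual d lam \<mu>) \<cdot>\<^sub>m (spec d E (spike lam) * (spec d E \<mu> * U)) +
    8 \<cdot>\<^sub>m (spec d E (spike lam) * spec d E ?\<delta> * spec d E (spike lam) * (spec d E \<mu> * U))"
    unfolding grad_loss[OF cov_factor w W] \<Delta> unfolding cov_spec f ..
  also have "\<dots> = ((4 * residual d lam \<mu>) \<cdot>\<^sub>m (spec d E (spike lam) * spec d E \<mu>) +
    8 \<cdot>\<^sub>m (spec d E (spike lam) * spec d E ?\<delta> * spec d E (spike lam) * spec d E \<mu>)) * U"
    using Uc sc by (simp add: add_mult_distrib_mat[of _ d d _ _ d] mult_smult_assoc_mat[of _ d d _ d] assoc_mult_mat[of _ d d _ d _ d])
  also have "(4 * residual d lam \<mu>) \<cdot>\<^sub>m (spec d E (spike lam) * spec d E \<mu>) +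
    8 \<cdot>\<^sub>m (spec d E (spike lam) * spec d E ?\<delta> * spec d E (spike lam) * spec d E \<mu>) = spec d E (grad_ev d lam \<mu>)"
    unfolding spec_mult[OF E(1)] spec_smult[OF E(1)] spec_add[OF E(1)]
    by (rule spec_cong[OF E(1)]) (simp add: grad_ev_def algebra_simps)
  finally show ?thesis .
qed

lemma pgd_spec:
  "pgd (loss d (1\<^sub>m d + lam \<cdot>\<^sub>m outer v v) w \<sigma>) \<eta> (\<theta> \<cdot>\<^sub>m U) k = spec d E (iterate_ev d lam \<eta> \<theta> k) * U"
proof (induction k)
  case 0
  have "spec d E (\<lambda>_. \<theta>) = \<theta> \<cdot>\<^sub>m 1\<^sub>m d"
    unfolding spec_one[OF E(1), symmetric] spec_smult[OF E(1)] by simp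
  thus ?case using orth_matD[OF U] by (simp add: mult_smult_assoc_mat[of _ d d _ d])
next
  case (Suc k)
  note Uc = orth_matD[OF U] and sc = spec_carrier[OF E(1)]
  let ?\<mu> = "iterate_ev d lam \<eta> \<theta> k"
  have "pgd (loss d (1\<^sub>m d + lam \<cdot>\<^sub>m outer v v) w \<sigma>) \<eta> (\<theta> \<cdot>\<^sub>m U) (Suc k) =
    spec d E ?\<mu> * U - \<eta> \<cdot>\<^sub>m (spec d E (\<lambda>i. sgn (grad_ev d lam ?\<mu> i)) * U)"
    by (simp add: Suc grad_loss_spec polar_spec_mult_orth[OF E(1) U])
  also have "\<dots> = (spec d E ?\<mu> - \<eta> \<cdot>\<^sub>m spec d E (\<lambda>i. sgn (grad_ev d lam ?\<mu> i))) * U"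
    using Uc sc by (simp add: minus_mult_distrib_mat[of _ d d _ _ d] mult_smult_assoc_mat[of _ d d _ d])
  also have "\<dots> = spec d E (iterate_ev d lam \<eta> \<theta> (Suc k)) * U"
    unfolding spec_smult[OF E(1)] spec_diff[OF E(1)] by simp
  finally show ?case .
qed

lemma quadratic_form_spec:
  "w \<bullet> (spec d E f *\<^sub>v w) = f 0" "v \<bullet> (spec d E f *\<^sub>v v) = f 1"
  "frob_inner (spec d E f) (outer w w) = f 0"
proof -
  have dims: "dim_vec w = d" "dim_vec v = d" using E by (auto simp: orth_mat_def)
  have *: "(\<Sum>i<d. f i * of_bool (i = k)) = f k" if "k < d" for k
  proof -
    have "(\<Sum>i<d. f i * of_bool (i = k)) = (\<Sum>i<d. if i = k then f k else 0)" by (intro sum.cong) auto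
    thus ?thesis using that by simp
  qed
  show 1: "frob_inner (spec d E f) (outer w w) = f 0"
    unfolding outer_spec frob_inner_spec[OF E(1)] using * d by simp
  have 2: "frob_inner (spec d E f) (outer v v) = f 1"
    unfolding outer_spec frob_inner_spec[OF E(1)] using *[of 1] d by simp
  show "w \<bullet> (spec d E f *\<^sub>v w) = f 0" "v \<bullet> (spec d E f *\<^sub>v v) = f 1"
    using 1 2 frob_inner_outer[OF spec_carrier(1)[OF E(1)]] dims by simp_all
qed

end

section \<open>Alignment and choice of constants\<close>

text \<open>The root is at most a (1 + \<epsilon>), and 1/(1 + \<epsilon>) is at least 1 -
  \<epsilon>.\<close>

lemma alignment_bound:
  fixes a r \<epsilon> :: real
  assumes "a > 0" "\<epsilon> > 0" "r \<le> \<epsilon> * a\<^sup>2" "r \<ge> 0"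
  shows "1 - \<epsilon> \<le> a / sqrt (a\<^sup>2 + r)"
proof -
  have "a\<^sup>2 + r \<le> (a * (1 + \<epsilon>))\<^sup>2"
  proof -
    have "(a * (1 + \<epsilon>))\<^sup>2 = a\<^sup>2 + 2 * (\<epsilon> * a\<^sup>2) + \<epsilon>\<^sup>2 * a\<^sup>2"
      by (simp add: power2_eq_square algebra_simps)
    moreover have "0 \<le> \<epsilon> * a\<^sup>2" "0 \<le> \<epsilon>\<^sup>2 * a\<^sup>2" using assms by auto
    ultimately show ?thesis using assms(3) by linarith
  qed
  hence "sqrt (a\<^sup>2 + r) \<le> a * (1 + \<epsilon>)" using assms by (intro real_le_lsqrt) auto
  moreover have pos: "0 < sqrt (a\<^sup>2 + r)" using assms by (simp add: add_pos_nonneg)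
  ultimately have "a / (a * (1 + \<epsilon>)) \<le> a / sqrt (a\<^sup>2 + r)" using assms by (intro divide_left_mono) auto
  moreover have "1 - \<epsilon> \<le> 1 / (1 + \<epsilon>)"
  proof -
    have "(1 - \<epsilon>) * (1 + \<epsilon>) \<le> 1" by (simp add: algebra_simps)
    thus ?thesis using assms by (simp add: pos_le_divide_eq)
  qed
  ultimately show ?thesis using assms by simp
qed

text \<open>Non-asymptotic form of the result: \<open>ln\<close> makes the initialisation small
  enough, and \<open>r\<close> makes the part of the squared norm outside the signal at most
  \<epsilon> times the squared signal, given that the latter is at least the square of
  \<delta>/4.\<close>

lemma trajectory:
  fixes d :: nat and \<kappa> \<delta> \<epsilon> lam \<sigma> :: real and w v :: "real Matrix.vec"
  assumes \<kappa>: "0 < \<kappa>" "\<kappa> \<le> 1/20" and \<delta>: "0 < \<delta>" "\<delta> \<le> 1/4" and \<epsilon>: "\<epsilon> > 0"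
    and d: "d \<ge> 4" and lam: "lam \<ge> 1" and ln: "3 * (1 + lam) + real d < real d * ln (real d)"
    and r: "1 / (4 * (1 + lam)\<^sup>2) + 25 / (16 * (real d - 2)) \<le> \<epsilon> * (\<delta>\<^sup>2 / 16)"
    and dim: "dim_vec w = d" "dim_vec v = d" and orth: "w \<bullet> w = 1" "v \<bullet> v = 1" "v \<bullet> w = 0"
    and U: "orth_mat d U"
    and Q: "Q = 1\<^sub>m d + lam \<cdot>\<^sub>m outer v v"
    and Pperp: "Pperp = 1\<^sub>m d - outer w w - outer v v"
    and \<eta>: "\<eta> = \<kappa> / sqrt (real d + lam)"
    and W: "W = pgd (loss d Q w \<sigma>) \<eta> (sqrt (1 / ln (real d) / real d) \<cdot>\<^sub>m U)"
    and M: "M = (\<lambda>k. W k * transpose_mat (W k))"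
    and a: "a = (\<lambda>k. w \<bullet> (M k *\<^sub>v w))"
    and b: "b = (\<lambda>k. v \<bullet> (M k *\<^sub>v v))"
    and c: "c = (\<lambda>k. frob_inner (M k) Pperp / (real d - 2))"
    and Align: "Align = (\<lambda>k. frob_inner (M k) (outer w w) / frob_norm (M k))"
    and T1: "T1 = (LEAST k. b (Suc k) \<le> b k)"
    and T2: "T2 = (LEAST k. T1 \<le> k \<and> \<delta> \<le> a k)"
    and C: "C = 4 / \<delta>"
  shows "(\<forall>k. M k = a k \<cdot>\<^sub>m outer w w + b k \<cdot>\<^sub>m outer v v + c k \<cdot>\<^sub>m Pperp) \<and>
          (\<exists>k. b (Suc k) \<le> b k) \<and> (\<exists>k. T1 \<le> k \<and> \<delta> \<le> a k) \<and>
          real T2 \<le> C / \<eta> \<and>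
          (\<forall>k. T1 \<le> k \<and> k \<le> T2 \<longrightarrow> a k = (sqrt (a 0) + real k * \<eta>)\<^sup>2) \<and>
          (\<forall>k \<ge> T1. \<bar>b k\<bar> \<le> C / (1 + lam) \<and> \<bar>c k\<bar> \<le> C / real d) \<and>
          (\<forall>k \<ge> T2. 1 / C \<le> a k \<and> a k \<le> C \<and> Align k \<ge> 1 - \<epsilon>)"
proof -
  obtain E where E: "orth_mat d E" "col E 0 = w" "col E 1 = v"
    using exists_orth_mat_two_cols[of d w v] d dim orth by auto
  have d2: "d \<ge> 2" and lam0: "lam \<ge> 0" using d lam by auto
  note ctx = E U d2 lam0
  define \<theta> where "\<theta> = sqrt (1 / ln (real d) / real d)"
  define \<mu> where "\<mu> = iterate_ev d lam \<eta> \<theta>"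
  have lnpos: "ln (real d) > 0" using d by simp
  have \<theta>2: "\<theta>\<^sup>2 = 1 / (real d * ln (real d))" using lnpos by (simp add: \<theta>_def mult.commute)
  have Mk: "M k = spec d E (\<lambda>i. (\<mu> k i)\<^sup>2)" for k
    unfolding M W Q \<theta>_def[symmetric] pgd_spec[OF ctx] \<mu>_def spec_mult_orth_square[OF E(1) U] ..
  have bulk: "i \<ge> 2 \<Longrightarrow> \<mu> k i = \<mu> k 2" for k i unfolding \<mu>_def by (rule iterate_ev_bulk)
  have ak: "a k = (\<mu> k 0)\<^sup>2" and bk: "b k = (\<mu> k 1)\<^sup>2" for k
    unfolding a b Mk quadratic_form_spec[OF ctx] by auto
  have ck: "c k = (\<mu> k 2)\<^sup>2" for k
  proof -
    have "(\<Sum>i<d. (\<mu> k i)\<^sup>2 * of_bool (2 \<le> i)) = (real d - 2) * (\<mu> k 2)\<^sup>2"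
    proof (subst sum_split_two[OF d2])
      show "(\<mu> k i)\<^sup>2 * of_bool (2 \<le> i) = (\<mu> k 2)\<^sup>2 * of_bool ((2::nat) \<le> 2)" if "i \<ge> 2" for i
        using bulk[OF that, of k] that by simp
    qed simp
    thus ?thesis using d unfolding c Mk Pperp bulk_spec[OF ctx] frob_inner_spec[OF E(1)] by simp
  qed
  have norm: "frob_norm (M k) = sqrt ((a k)\<^sup>2 + ((b k)\<^sup>2 + (real d - 2) * (c k)\<^sup>2))" for k
  proof -
    have "(\<Sum>i<d. (\<mu> k i)\<^sup>2 * (\<mu> k i)\<^sup>2) = (a k)\<^sup>2 + ((b k)\<^sup>2 + (real d - 2) * (c k)\<^sup>2)"
    proof (subst sum_split_two[OF d2])
      show "(\<mu> k i)\<^sup>2 * (\<mu> k i)\<^sup>2 = (\<mu> k 2)\<^sup>2 * (\<mu> k 2)\<^sup>2" if "i \<ge> 2" for i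
        using bulk[OF that, of k] by simp
    qed (simp add: ak bk ck power2_eq_square)
    thus ?thesis unfolding frob_norm_def Mk frob_inner_spec[OF E(1)] by simp
  qed
  have \<eta>pos: "\<eta> > 0" using \<kappa> lam d by (simp add: \<eta>)
  interpret S: sign_dynamics \<eta> lam "real d - 2" \<kappa> \<theta> "\<lambda>k. \<mu> k 0" "\<lambda>k. \<mu> k 1" "\<lambda>k. \<mu> k 2" "\<lambda>k. residual d lam (\<mu> k)"
  proof
    \<comment> \<open>This is where the normalisation of \<eta> enters: both 1 + lam and d - 2 are
      at most d + lam.\<close>
    have scale: "\<eta> * sqrt x \<le> \<kappa>" if "x \<le> real d + lam" for x
    proof -
      have "\<eta> * sqrt x \<le> \<eta> * sqrt (real d + lam)" using that \<eta>pos by (intro mult_left_mono) auto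
      also have "\<dots> = \<kappa>" using d lam by (simp add: \<eta>)
      finally show ?thesis .
    qed
    show "\<eta> * sqrt (1 + lam) \<le> \<kappa>" "\<eta> * sqrt (real d - 2) \<le> \<kappa>" using d lam by (auto intro!: scale)
    show "\<theta> > 0" using lnpos d by (simp add: \<theta>_def)
    have "(3 * (1 + lam) + (real d - 2) + 1) < real d * ln (real d)" using ln by linarith
    thus "(3 * (1 + lam) + (real d - 2) + 1) * \<theta>\<^sup>2 < 1" unfolding \<theta>2 using lnpos d by simp
    fix k
    show "residual d lam (\<mu> k) = (\<mu> k 0)\<^sup>2 - 1 + (1 + lam) * (\<mu> k 1)\<^sup>2 + (real d - 2) * (\<mu> k 2)\<^sup>2"
      unfolding \<mu>_def by (rule residual_iterate_ev[OF d2])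
    show "\<mu> (Suc k) 0 = \<mu> k 0 - \<eta> * (sgn (2 * ((\<mu> k 0)\<^sup>2 - 1) + residual d lam (\<mu> k)) * sgn (\<mu> k 0))"
      "\<mu> (Suc k) 1 = \<mu> k 1 - \<eta> * (sgn (2 * (1 + lam) * (\<mu> k 1)\<^sup>2 + residual d lam (\<mu> k)) * sgn (\<mu> k 1))"
      "\<mu> (Suc k) 2 = \<mu> k 2 - \<eta> * (sgn (2 * (\<mu> k 2)\<^sup>2 + residual d lam (\<mu> k)) * sgn (\<mu> k 2))"
      by (simp_all add: \<mu>_def sgn_grad_ev[OF lam0] spike_def)
  qed (use \<eta>pos lam d \<kappa> in \<open>auto simp: \<mu>_def\<close>)
  have T1': "T1 = S.T1" and T2': "T2 = S.T2 \<delta>"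
    unfolding T1 T2 S.T1_def S.T2_def bk ak by auto
  \<comment> \<open>The constant is 4/\<delta> because \<delta>/4 is the lower bound on a_k;
    \<delta> \<le> 1/4 makes it large enough for all the other bounds.\<close>
  have C16: "C \<ge> 16" unfolding C using \<delta> by (simp add: field_simps)
  have bC: "b k * (1 + lam) \<le> 1/2" for k using S.beta_bound[of k] by (simp add: bk mult.commute)
  have cC: "c k * (real d - 2) \<le> 5/4" for k using S.gamma_bound[of k] by (simp add: ck mult.commute)
  have b_le: "b k \<le> 1 / (2 * (1 + lam))" for k using bC[of k] lam by (simp add: field_simps)
  have c_le: "c k \<le> 5 / (4 * (real d - 2))" for k using cC[of k] d by (simp add: field_simps)
  have "M k = a k \<cdot>\<^sub>m outer w w + b k \<cdot>\<^sub>m outer v v + c k \<cdot>\<^sub>m Pperp" for k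
    unfolding Mk Pperp bulk_spec[OF ctx] unfolding outer_spec[OF ctx] spec_smult[OF E(1)] spec_add[OF E(1)]
  proof (rule spec_cong[OF E(1)])
    fix i :: nat
    consider "i = 0" | "i = 1" | "i \<ge> 2" by linarith
    thus "(\<mu> k i)\<^sup>2 = a k * of_bool (i = 0) + b k * of_bool (i = 1) + c k * of_bool (2 \<le> i)"
      by cases (use bulk[of i k] in \<open>auto simp: ak bk ck\<close>)
  qed
  moreover have "\<exists>k. b (Suc k) \<le> b k" using S.beta_stops by (simp add: bk)
  moreover have "\<exists>k. T1 \<le> k \<and> \<delta> \<le> a k" using S.reaches_level[OF \<delta>(2)] by (simp add: T1' ak)
  moreover have "real T2 \<le> C / \<eta>"
    unfolding T2' by (rule order_trans[OF S.T2_le[OF \<delta>(2)]]) (use C16 \<eta>pos in \<open>simp add: divide_right_mono\<close>)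
  moreover have "a k = (sqrt (a 0) + real k * \<eta>)\<^sup>2" if "k \<le> T2" for k
    using S.T2_props(3)[OF \<delta>(2), of k] that S.theta_pos unfolding T2' ak by (simp add: S.init)
  moreover have "\<bar>b k\<bar> \<le> C / (1 + lam)" for k
  proof -
    have "b k \<le> C / (1 + lam)" using bC[of k] C16 lam by (simp add: pos_le_divide_eq)
    thus ?thesis by (simp add: bk)
  qed
  moreover have "\<bar>c k\<bar> \<le> C / real d" for k
  proof -
    \<comment> \<open>As d \<ge> 4, the multiplicity d - 2 is at least d/2, which gives the order
      1/d.\<close>
    have "c k * (real d / 2) \<le> c k * (real d - 2)" using d by (intro mult_left_mono) (auto simp: ck)
    hence "c k \<le> C / real d" using cC[of k] C16 d by (simp add: pos_le_divide_eq)
    thus ?thesis by (simp add: ck)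
  qed
  moreover have "1 / C \<le> a k \<and> a k \<le> C \<and> Align k \<ge> 1 - \<epsilon>" if "k \<ge> T2" for k
  proof (intro conjI)
    note \<alpha> = S.alpha_after_T2[OF \<delta> that[unfolded T2']]
    have "(sqrt \<delta> / 2)\<^sup>2 \<le> a k" unfolding ak using \<alpha>(1) \<delta> by (intro power_mono) auto
    hence a1: "\<delta> / 4 \<le> a k" using \<delta> by (simp add: power_divide)
    thus "1 / C \<le> a k" by (simp add: C)
    have "0 < sqrt \<delta> / 2" using \<delta> by simp
    hence "a k \<le> 2\<^sup>2" unfolding ak using \<alpha> by (intro power_mono) linarith+
    thus "a k \<le> C" using C16 by simp
    define R where "R = (b k)\<^sup>2 + (real d - 2) * (c k)\<^sup>2"
    have square: "x * (5 / (4 * x))\<^sup>2 = 25 / (16 * x)" if "x > 0" for x :: real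
      using that by (simp add: power2_eq_square field_simps)
    have "(b k)\<^sup>2 \<le> (1 / (2 * (1 + lam)))\<^sup>2" using b_le[of k] by (intro power_mono) (auto simp: bk)
    also have "\<dots> = 1 / (4 * (1 + lam)\<^sup>2)" by (simp add: power_divide power2_eq_square algebra_simps)
    finally have "(b k)\<^sup>2 \<le> 1 / (4 * (1 + lam)\<^sup>2)" .
    moreover have "(real d - 2) * (c k)\<^sup>2 \<le> (real d - 2) * (5 / (4 * (real d - 2)))\<^sup>2"
      using c_le[of k] d by (intro mult_left_mono power_mono) (auto simp: ck)
    moreover have "(real d - 2) * (5 / (4 * (real d - 2)))\<^sup>2 = 25 / (16 * (real d - 2))"
      by (rule square) (use d in simp)
    ultimately have "R \<le> \<epsilon> * (\<delta>\<^sup>2 / 16)" using r unfolding R_def by linarith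
    also have "\<delta>\<^sup>2 / 16 = (\<delta> / 4)\<^sup>2" by (simp add: power_divide)
    also have "\<epsilon> * (\<delta> / 4)\<^sup>2 \<le> \<epsilon> * (a k)\<^sup>2" using a1 \<delta> \<epsilon> by (intro mult_left_mono power_mono) auto
    finally have R: "R \<le> \<epsilon> * (a k)\<^sup>2" .
    have "1 - \<epsilon> \<le> a k / sqrt ((a k)\<^sup>2 + R)"
      using R a1 \<delta> \<epsilon> d by (intro alignment_bound) (auto simp: R_def)
    moreover have "Align k = a k / sqrt ((a k)\<^sup>2 + R)"
      unfolding Align norm R_def unfolding Mk quadratic_form_spec[OF ctx] ak ..
    ultimately show "Align k \<ge> 1 - \<epsilon>" by simp
  qed
  ultimately show ?thesis by blast
qed

text \<open>The conditions are taken at the worst admissible spike: the upper end c2 d for the small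
  initialisation, where d ln d dominates, and the lower end c1 ln d for the decay of the
  remainder.\<close>

lemma eventually_dimension_large:
  fixes c1 c2 e :: real
  assumes "c1 > 0" "c2 > 0" "e > 0"
  shows "\<exists>D. \<forall>d\<ge>D. d \<ge> 4 \<and> c1 * ln (real d) \<ge> 1 \<and> 3 * (1 + c2 * real d) + real d < real d * ln (real d) \<and>
    1 / (4 * (1 + c1 * ln (real d))\<^sup>2) + 25 / (16 * (real d - 2)) \<le> e"
proof -
  have "filterlim (\<lambda>d::nat. c1 * ln (real d)) at_top sequentially" using assms by real_asymp
  hence "eventually (\<lambda>d::nat. c1 * ln (real d) \<ge> 1) sequentially" unfolding filterlim_at_top by blast
  moreover have "filterlim (\<lambda>d::nat. real d * ln (real d) - (3 * (1 + c2 * real d) + real d)) at_top sequentially"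
    using assms by real_asymp
  hence "eventually (\<lambda>d::nat. real d * ln (real d) - (3 * (1 + c2 * real d) + real d) \<ge> 1) sequentially"
    unfolding filterlim_at_top by blast
  moreover have "((\<lambda>d::nat. 1 / (4 * (1 + c1 * ln (real d))\<^sup>2) + 25 / (16 * (real d - 2))) \<longlongrightarrow> 0) sequentially"
    using assms by real_asymp
  hence "eventually (\<lambda>d::nat. 1 / (4 * (1 + c1 * ln (real d))\<^sup>2) + 25 / (16 * (real d - 2)) < e) sequentially"
    using assms(3) by (rule order_tendstoD)
  moreover have "eventually (\<lambda>d::nat. d \<ge> 4) sequentially" by (rule eventually_ge_at_top)
  ultimately have "eventually (\<lambda>d::nat. d \<ge> 4 \<and> c1 * ln (real d) \<ge> 1 \<and> 3 * (1 + c2 * real d) + real d < real d * ln (real d) \<and>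
    1 / (4 * (1 + c1 * ln (real d))\<^sup>2) + 25 / (16 * (real d - 2)) \<le> e) sequentially"
    by eventually_elim auto
  thus ?thesis unfolding eventually_sequentially .
qed

text \<open>As m = d, the Stiefel manifold is the orthogonal group, so treating every orthogonal
  \<open>U\<close> covers each realisation of the random start. \<open>C\<close> is chosen before
  \<epsilon>, while \<open>D\<close> may depend on \<epsilon>; this expresses 1 - o(1) uniformly in
  k and in the data.\<close>

theorem theorem4p2:
  fixes c1 c2 :: real
  assumes "c1 > 0" and "c2 > 0"
  shows "\<exists>\<kappa>0 > 0. \<exists>\<delta>0 > 0. \<forall>\<kappa> \<delta>. 0 < \<kappa> \<and> \<kappa> \<le> \<kappa>0 \<and> 0 < \<delta> \<and> \<delta> \<le> \<delta>0 \<longrightarrow>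
    (\<exists>C > 0. \<forall>\<epsilon> > 0. \<exists>D::nat. \<forall>d \<ge> D. \<forall>(lam::real) (wstar::real Matrix.vec) (v::real Matrix.vec) (\<sigma>::real) U.
      c1 * ln (real d) \<le> lam \<and> lam \<le> c2 * real d \<and>
      dim_vec wstar = d \<and> dim_vec v = d \<and> wstar \<bullet> wstar = 1 \<and> v \<bullet> v = 1 \<and> v \<bullet> wstar = 0 \<and>
      orth_mat d U \<longrightarrow>
      (let Q = 1\<^sub>m d + lam \<cdot>\<^sub>m outer v v;
           Pperp = 1\<^sub>m d - outer wstar wstar - outer v v;
           L = loss d Q wstar \<sigma>;
           \<rho>0 = 1 / ln (real d);
           \<theta> = sqrt (\<rho>0 / real d);
           \<eta> = \<kappa> / sqrt (real d + lam);
           W = pgd L \<eta> (\<theta> \<cdot>\<^sub>m U);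
           M = (\<lambda>k. W k * transpose_mat (W k));
           a = (\<lambda>k. wstar \<bullet> (M k *\<^sub>v wstar));
           b = (\<lambda>k. v \<bullet> (M k *\<^sub>v v));
           c = (\<lambda>k. frob_inner (M k) Pperp / (real d - 2));
           Align = (\<lambda>k. frob_inner (M k) (outer wstar wstar) / frob_norm (M k));
           T1 = (LEAST k. b (Suc k) \<le> b k);
           T2 = (LEAST k. T1 \<le> k \<and> \<delta> \<le> a k)
       in (\<forall>k. M k = a k \<cdot>\<^sub>m outer wstar wstar + b k \<cdot>\<^sub>m outer v v + c k \<cdot>\<^sub>m Pperp) \<and>
          (\<exists>k. b (Suc k) \<le> b k) \<and> (\<exists>k. T1 \<le> k \<and> \<delta> \<le> a k) \<and>
          real T2 \<le> C / \<eta> \<and>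
          (\<forall>k. T1 \<le> k \<and> k \<le> T2 \<longrightarrow> a k = (sqrt (a 0) + real k * \<eta>)\<^sup>2) \<and>
          (\<forall>k \<ge> T1. \<bar>b k\<bar> \<le> C / (1 + lam) \<and> \<bar>c k\<bar> \<le> C / real d) \<and>
          (\<forall>k \<ge> T2. 1 / C \<le> a k \<and> a k \<le> C \<and> Align k \<ge> 1 - \<epsilon>)))"
proof -
  have D: "\<exists>D. \<forall>d\<ge>D. \<forall>lam. c1 * ln (real d) \<le> lam \<and> lam \<le> c2 * real d \<longrightarrow>
      d \<ge> 4 \<and> lam \<ge> 1 \<and> 3 * (1 + lam) + real d < real d * ln (real d) \<and>
      1 / (4 * (1 + lam)\<^sup>2) + 25 / (16 * (real d - 2)) \<le> e" if e: "e > 0" for e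
  proof -
    obtain D where D: "\<And>d. d \<ge> D \<Longrightarrow> d \<ge> 4 \<and> c1 * ln (real d) \<ge> 1 \<and>
      3 * (1 + c2 * real d) + real d < real d * ln (real d) \<and>
      1 / (4 * (1 + c1 * ln (real d))\<^sup>2) + 25 / (16 * (real d - 2)) \<le> e"
      using eventually_dimension_large[OF assms e] by auto
    \<comment> \<open>The remainder decreases in \<open>lam\<close>, so the lower end of its range
      is the worst case.\<close>
    have "1 / (4 * (1 + lam)\<^sup>2) \<le> 1 / (4 * (1 + c1 * ln (real d))\<^sup>2)"
      if "d \<ge> D" "c1 * ln (real d) \<le> lam" for d lam
      using that D[of d] by (intro divide_left_mono mult_left_mono power_mono) auto
    thus ?thesis using D by (intro exI[of _ D]) fastforce
  qed
  show ?thesis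
    \<comment> \<open>The thresholds 1/20 for \<kappa> and 1/4 for \<delta> are those of the sign
      dynamics.\<close>
    apply (rule exI[of _ "1/20"], rule conjI, simp)
    apply (rule exI[of _ "1/4"], rule conjI, simp)
    apply (intro allI impI, elim conjE)
    subgoal premises \<kappa>\<delta> for \<kappa> \<delta>
      apply (rule exI[of _ "4 / \<delta>"], rule conjI, use \<kappa>\<delta> in simp)
      apply (intro allI impI)
      subgoal premises \<epsilon> for \<epsilon>
        \<comment> \<open>The tolerance is \<epsilon> times the square of the lower bound \<delta>/4
          on a_k.\<close>
        apply (rule exE[OF D[of "\<epsilon> * (\<delta>\<^sup>2 / 16)"]], use \<kappa>\<delta> \<epsilon> in simp)
        subgoal premises D for D
          apply (intro exI[of _ D] allI impI, elim conjE)
          subgoal premises p for d lam w v \<sigma> U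
            unfolding Let_def
            by (rule trajectory[OF \<kappa>\<delta> \<epsilon> _ _ _ _ p(4-9) refl refl refl refl refl refl refl refl refl refl refl refl])
               (use D p(1-3) in auto)
          done
        done
      done
    done
qed

end
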